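(* Let $\omega,\gamma,\lambda$ be strictly positive sequences with $\gamma_1=\omega_1=\lambda_1=1$ such that $(\omega_j/\gamma_j)_{j\ge1}$ and $(\lambda_j)_{j\ge1}$ are non-increasing. For $\varepsilon,\sigma\in(0,1)$ define $$\rho_{k,\varepsilon}:=\max\Big(\frac{\omega_k}{\gamma_k},\sum_{j=1}^k\frac{\varepsilon\,\omega_j}{\lambda_j}\Big),\quad \kappa_\varepsilon:=\min_{k\in\mathbb N}\rho_{k,\varepsilon},\quad k^*_\varepsilon:=\operatorname{argmin}_{k\in\mathbb N}\rho_{k,\varepsilon},\quad \upsilon_\sigma:=\max_{k\in\mathbb N}\Big\{\frac{\omega_k}{\gamma_k}\min\Big(1,\frac{\sigma}{\lambda_k}\Big)\Big\}.$$ If $$\eta:=\inf_{\varepsilon\in(0,1)}\Big\{\kappa_\varepsilon^{-1}\min\Big(\frac{\omega_{k^*_\varepsilon}}{\gamma_{k^*_\varepsilon}},\sum_{l=1}^{k^*_\varepsilon}\frac{\varepsilon\,\omega_l}{\lambda_l}\Big)\Big\}>0,$$ then for all $\varepsilon,\sigma\in(0,1)$ $$\inf_{\tilde f}\ \sup_{f\in\mathcal F_\gamma^r}\ \sup_{T\in\mathcal T_\lambda^d}\mathbb E\|\tilde f-f\|_\omega^2\ \ge\ \frac1{4d}\,\min(\eta,r)\,\min\Big(r,\frac1{2d},(1-d^{-1/2})^2\Big)\,\max(\kappa_\varepsilon,\upsilon_\sigma),$$ where the infimum is over all estimators $\tilde f$ of $f$ (measurable functions of the observations $(X,Y)$).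
   Context: Let $H,G$ be real infinite-dimensional separable Hilbert spaces, $(\varphi_j)_{j\ge1}$ a fixed orthonormal basis of $H$ and $(\psi_j)_{j\ge1}$ a fixed orthonormal system in $G$. For $h\in H$ put $[h]_j:=\langle h,\varphi_j\rangle_H$. Let $C(H,G)$ be the set of compact linear operators $T:H\to G$ with $T\varphi_j=a_j\psi_j$ and $a_j>0$ for all $j$; $(a_j)$ are the singular values of $T$, so $T^*T$ has eigenvalues $a_j^2$. Model: for noise levels $\varepsilon,\sigma\in(0,1)$, unknown $f\in H$ and unknown $T\in C(H,G)$ with singular values $(a_j)$, one observes $Y=(Y_j)_{j\ge1}$ and $X=(X_j)_{j\ge1}$ with $$Y_j=a_j[f]_j+\sqrt\varepsilon\,\xi_j,\qquad X_j=a_j+\sqrt\sigma\,\zeta_j,$$ where all $\xi_j,\zeta_j$ are i.i.d. standard normal. $\mathbb E$ is the expectation under this model. For a positive sequence $w$, $\|h\|_w^2:=\sum_{j\ge1}w_j|[h]_j|^2$ (possibly $+\infty$). For $r>0$, $d\ge1$: $$\mathcal F_\gamma^r:=\{h\in H:\|h\|_\gamma^2\le r\},\qquad \mathcal T_\lambda^d:=\{T\in C(H,G): 1/d\le a_j^2/\lambda_j\le d\ \ \forall j\ge1\}.$$ It is assumed that $\lambda_j\to0$ (equivalently, $\mathcal T_\lambda^d\neq\emptyset$). The argmin is the smallest minimizer; the notation presupposes that the minimum over $k$ is attained. *)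

theory Defs
  imports "HOL-Probability.Probability"
begin

text \<open>All sequences are indexed by the integers \<open>j \<ge> 1\<close>; values at index \<open>0\<close> are never used.
  A real separable Hilbert space is a type of class \<open>real_inner\<close> and \<open>polish_space\<close> (complete and
  second countable). The orthonormal sequences make the spaces below infinite-dimensional.\<close>

definition orthonormal_system :: "(nat \<Rightarrow> 'a::real_inner) \<Rightarrow> bool" where
  "orthonormal_system e \<longleftrightarrow> (\<forall>i\<ge>1. \<forall>j\<ge>1. e i \<bullet> e j = (if i = j then 1 else 0))"

definition orthonormal_basis :: "(nat \<Rightarrow> 'a::real_inner) \<Rightarrow> bool" where
  "orthonormal_basis e \<longleftrightarrow> orthonormal_system e \<and> closure (span (e ` {1..})) = UNIV"

definition compact_operator :: "('a::real_normed_vector \<Rightarrow> 'b::real_normed_vector) \<Rightarrow> bool" where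
  "compact_operator T \<longleftrightarrow> bounded_linear T \<and> compact (closure (T ` ball 0 1))"

definition op_class ::
  "(nat \<Rightarrow> 'h::real_inner) \<Rightarrow> (nat \<Rightarrow> 'g::real_inner) \<Rightarrow> ('h \<Rightarrow> 'g) set" where
  "op_class \<phi> \<psi> = {T. compact_operator T \<and> (\<exists>a. \<forall>j\<ge>1. a j > 0 \<and> T (\<phi> j) = a j *\<^sub>R \<psi> j)}"

text \<open>On \<open>op_class \<phi> \<psi>\<close> with \<open>\<psi>\<close> orthonormal, this is the number \<open>a\<^sub>j\<close> with
  \<open>T \<phi>\<^sub>j = a\<^sub>j \<psi>\<^sub>j\<close>.\<close>
definition sing_val ::
  "(nat \<Rightarrow> 'h::real_inner) \<Rightarrow> (nat \<Rightarrow> 'g::real_inner) \<Rightarrow> ('h \<Rightarrow> 'g) \<Rightarrow> nat \<Rightarrow> real" where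
  "sing_val \<phi> \<psi> T j = T (\<phi> j) \<bullet> \<psi> j"

definition coef :: "(nat \<Rightarrow> 'h::real_inner) \<Rightarrow> 'h \<Rightarrow> nat \<Rightarrow> real" where
  "coef \<phi> h j = h \<bullet> \<phi> j"

definition wnorm_sq :: "(nat \<Rightarrow> 'h::real_inner) \<Rightarrow> (nat \<Rightarrow> real) \<Rightarrow> 'h \<Rightarrow> ennreal" where
  "wnorm_sq \<phi> w h = (\<Sum>\<^sub>\<infinity>j\<in>{1..}. ennreal (w j * \<bar>coef \<phi> h j\<bar>\<^sup>2))"

definition sol_class :: "(nat \<Rightarrow> 'h::real_inner) \<Rightarrow> (nat \<Rightarrow> real) \<Rightarrow> real \<Rightarrow> 'h set" where
  "sol_class \<phi> \<gamma> r = {h. wnorm_sq \<phi> \<gamma> h \<le> ennreal r}"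

definition link_class ::
  "(nat \<Rightarrow> 'h::real_inner) \<Rightarrow> (nat \<Rightarrow> 'g::real_inner) \<Rightarrow> (nat \<Rightarrow> real) \<Rightarrow> real \<Rightarrow> ('h \<Rightarrow> 'g) set" where
  "link_class \<phi> \<psi> lam d =
    {T \<in> op_class \<phi> \<psi>. \<forall>j\<ge>1. 1 / d \<le> (sing_val \<phi> \<psi> T j)\<^sup>2 / lam j \<and> (sing_val \<phi> \<psi> T j)\<^sup>2 / lam j \<le> d}"

definition iid_std_normal_noise ::
  "'m measure \<Rightarrow> (nat \<Rightarrow> 'm \<Rightarrow> real) \<Rightarrow> (nat \<Rightarrow> 'm \<Rightarrow> real) \<Rightarrow> bool" where
  "iid_std_normal_noise M \<xi> \<zeta> \<longleftrightarrow>
    prob_space M \<and>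
    prob_space.indep_vars M (\<lambda>_. borel) (case_sum \<xi> \<zeta>) ({1..} <+> {1..}) \<and>
    (\<forall>j\<ge>1. distributed M lborel (\<xi> j) std_normal_density \<and>
           distributed M lborel (\<zeta> j) std_normal_density)"

text \<open>Observations are points of the product space over the index set \<open>{1..}\<close>, whose elements
  are undefined outside \<open>{1..}\<close>; hence the restricted abstraction.\<close>

definition obs_Y ::
  "(nat \<Rightarrow> 'h::real_inner) \<Rightarrow> (nat \<Rightarrow> 'g::real_inner) \<Rightarrow> (nat \<Rightarrow> 'm \<Rightarrow> real) \<Rightarrow> real
    \<Rightarrow> 'h \<Rightarrow> ('h \<Rightarrow> 'g) \<Rightarrow> 'm \<Rightarrow> nat \<Rightarrow> real" where
  "obs_Y \<phi> \<psi> \<xi> \<epsilon> f T x = (\<lambda>j\<in>{1..}. sing_val \<phi> \<psi> T j * coef \<phi> f j + sqrt \<epsilon> * \<xi> j x)"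

definition obs_X ::
  "(nat \<Rightarrow> 'h::real_inner) \<Rightarrow> (nat \<Rightarrow> 'g::real_inner) \<Rightarrow> (nat \<Rightarrow> 'm \<Rightarrow> real) \<Rightarrow> real
    \<Rightarrow> ('h \<Rightarrow> 'g) \<Rightarrow> 'm \<Rightarrow> nat \<Rightarrow> real" where
  "obs_X \<phi> \<psi> \<zeta> \<sigma> T x = (\<lambda>j\<in>{1..}. sing_val \<phi> \<psi> T j + sqrt \<sigma> * \<zeta> j x)"

definition estimators :: "((nat \<Rightarrow> real) \<times> (nat \<Rightarrow> real) \<Rightarrow> 'h::topological_space) set" where
  "estimators = borel_measurable (PiM {1..} (\<lambda>_. borel) \<Otimes>\<^sub>M PiM {1..} (\<lambda>_. borel))"

definition risk ::
  "'m measure \<Rightarrow> (nat \<Rightarrow> 'm \<Rightarrow> real) \<Rightarrow> (nat \<Rightarrow> 'm \<Rightarrow> real)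
    \<Rightarrow> (nat \<Rightarrow> 'h::real_inner) \<Rightarrow> (nat \<Rightarrow> 'g::real_inner) \<Rightarrow> (nat \<Rightarrow> real) \<Rightarrow> real \<Rightarrow> real
    \<Rightarrow> ((nat \<Rightarrow> real) \<times> (nat \<Rightarrow> real) \<Rightarrow> 'h) \<Rightarrow> 'h \<Rightarrow> ('h \<Rightarrow> 'g) \<Rightarrow> ennreal" where
  "risk M \<xi> \<zeta> \<phi> \<psi> \<omega> \<epsilon> \<sigma> est f T =
    (\<integral>\<^sup>+x. wnorm_sq \<phi> \<omega> (est (obs_X \<phi> \<psi> \<zeta> \<sigma> T x, obs_Y \<phi> \<psi> \<xi> \<epsilon> f T x) - f) \<partial>M)"

definition rho :: "(nat \<Rightarrow> real) \<Rightarrow> (nat \<Rightarrow> real) \<Rightarrow> (nat \<Rightarrow> real) \<Rightarrow> real \<Rightarrow> nat \<Rightarrow> real" where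
  "rho \<omega> \<gamma> lam \<epsilon> k = max (\<omega> k / \<gamma> k) (\<Sum>j=1..k. \<epsilon> * \<omega> j / lam j)"

definition rho_min_attained ::
  "(nat \<Rightarrow> real) \<Rightarrow> (nat \<Rightarrow> real) \<Rightarrow> (nat \<Rightarrow> real) \<Rightarrow> real \<Rightarrow> bool" where
  "rho_min_attained \<omega> \<gamma> lam \<epsilon> \<longleftrightarrow> (\<exists>k\<ge>1. \<forall>l\<ge>1. rho \<omega> \<gamma> lam \<epsilon> k \<le> rho \<omega> \<gamma> lam \<epsilon> l)"

text \<open>A minimum whenever \<open>rho_min_attained\<close> holds.\<close>
definition kappa :: "(nat \<Rightarrow> real) \<Rightarrow> (nat \<Rightarrow> real) \<Rightarrow> (nat \<Rightarrow> real) \<Rightarrow> real \<Rightarrow> real" where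
  "kappa \<omega> \<gamma> lam \<epsilon> = (INF k\<in>{1..}. rho \<omega> \<gamma> lam \<epsilon> k)"

definition kstar :: "(nat \<Rightarrow> real) \<Rightarrow> (nat \<Rightarrow> real) \<Rightarrow> (nat \<Rightarrow> real) \<Rightarrow> real \<Rightarrow> nat" where
  "kstar \<omega> \<gamma> lam \<epsilon> = (LEAST k. k \<ge> 1 \<and> (\<forall>l\<ge>1. rho \<omega> \<gamma> lam \<epsilon> k \<le> rho \<omega> \<gamma> lam \<epsilon> l))"

text \<open>If \<open>lam\<close> is positive with limit \<open>0\<close> and \<open>\<omega> / \<gamma>\<close> is positive and non-increasing, the supremum
  is a maximum: \<open>min 1 (\<sigma> / lam k) = 1\<close> for all large \<open>k\<close>, and from there on the terms do not
  increase.\<close>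
definition upsilon :: "(nat \<Rightarrow> real) \<Rightarrow> (nat \<Rightarrow> real) \<Rightarrow> (nat \<Rightarrow> real) \<Rightarrow> real \<Rightarrow> real" where
  "upsilon \<omega> \<gamma> lam \<sigma> = (SUP k\<in>{1..}. \<omega> k / \<gamma> k * min 1 (\<sigma> / lam k))"

definition eta :: "(nat \<Rightarrow> real) \<Rightarrow> (nat \<Rightarrow> real) \<Rightarrow> (nat \<Rightarrow> real) \<Rightarrow> real" where
  "eta \<omega> \<gamma> lam =
    (INF \<epsilon>\<in>{0<..<1}. inverse (kappa \<omega> \<gamma> lam \<epsilon>) *
       min (\<omega> (kstar \<omega> \<gamma> lam \<epsilon>) / \<gamma> (kstar \<omega> \<gamma> lam \<epsilon>))
           (\<Sum>l=1..kstar \<omega> \<gamma> lam \<epsilon>. \<epsilon> * \<omega> l / lam l))"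

end

theory Submission
  imports Defs
begin

text \<open>The risk over the two classes is bounded below by reducing to pairs of parameters that can
  hardly be told apart. Two features of the model make this elementary. All coordinates of
  the observation \<open>(X, Y)\<close> are independent Gaussians; and if two parameters \<open>(f, T)\<close> and
  \<open>(f', T')\<close> give means that differ in a single coordinate only, by at most \<open>\<surd>2\<close> standard
  deviations, then conditioning on all other coordinates leaves a one-dimensional Gaussian shift
  problem. There the Hellinger affinity of the two laws stays away from \<open>0\<close>, so any estimator of a
  real parameter with values \<open>c\<close> and \<open>c'\<close> has total squared risk at least \<open>(c - c')\<^sup>2 / 4\<close>
  (\<open>gaussian_shift_two_point\<close>, \<open>coordinate_loss_two_point\<close>). Averaging over the vertices of a
  hypercube of parameters adds up such bounds over several coordinates (\<open>assouad_risk_bound\<close>).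

  The two terms of the maximum come from two choices of hypercubes. For \<open>\<kappa>\<close>
  (\<open>known_operator_bound\<close>), \<open>T\<close> is fixed with \<open>a\<^sub>j\<^sup>2 = \<lambda>\<^sub>j\<close>, and \<open>f\<close> has coefficients
  \<open>\<plusminus>\<surd>(c \<epsilon> / \<lambda>\<^sub>j)\<close> for \<open>j \<le> k\<close>; the sign of the \<open>j\<close>-th one is visible in \<open>Y\<^sub>j\<close> only. The
  monotonicity of \<open>\<omega> / \<gamma>\<close> decides how large \<open>c\<close> may be, and the definition of \<open>\<eta>\<close> guarantees
  that at \<open>k = k\<^sup>*\<close> both the bias and the variance term are at least \<open>\<eta> \<kappa>\<close>. For \<open>\<upsilon>\<close>
  (\<open>unknown_operator_bound\<close>), only the \<open>k\<close>-th coordinate varies: the singular value is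
  \<open>(1 \<plusminus> \<alpha>) \<surd>\<lambda>\<^sub>k\<close> and the coefficient of \<open>f\<close> is \<open>(1 \<mp> \<alpha>) v\<close>, so that the law of \<open>Y\<close> is the same
  in both cases and the coefficient can be learned from \<open>X\<^sub>k\<close> alone.

  These parameters have to exist as compact operators. The operator with prescribed singular values
  \<open>a\<^sub>j \<rightarrow> 0\<close> is the norm limit of its finite-rank truncations (\<open>diagonal_operator_exists\<close>).\<close>

section \<open>Two-point bounds for Gaussian shifts\<close>

text \<open>With \<open>B = (c - c')\<^sup>2\<close>, densities \<open>p\<close>, \<open>q\<close> and affinity \<open>\<rho> = \<integral>\<surd>(p q)\<close>, the best possible integrand
  is \<open>B p q / (p + q)\<close>. This is bounded below by its tangent \<open>B (\<rho> \<surd>(p q) - \<rho>\<^sup>2 (p + q) / 4)\<close>, which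
  integrates to \<open>B \<rho>\<^sup>2 / 2\<close>; the condition on the means yields \<open>\<rho>\<^sup>2 \<ge> exp (-1/2) \<ge> 1/2\<close>.\<close>
lemma gaussian_shift_two_point:
  fixes h :: "real \<Rightarrow> real"
  assumes M: "prob_space M" and Z: "distributed M lborel Z std_normal_density"
    and h [measurable]: "h \<in> borel_measurable borel"
    and s: "s > 0" and close: "(m - m')\<^sup>2 \<le> 2 * s\<^sup>2"
  shows "ennreal ((c - c')\<^sup>2 / 4) \<le>
    (\<integral>\<^sup>+x. ennreal ((h (m + s * Z x) - c)\<^sup>2) \<partial>M) + (\<integral>\<^sup>+x. ennreal ((h (m' + s * Z x) - c')\<^sup>2) \<partial>M)"
proof -
  interpret prob_space M by fact
  define p where "p = normal_density m s"
  define q where "q = normal_density m' s"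
  define t where "t = normal_density ((m + m') / 2) s"
  define \<rho> where "\<rho> = exp (- (m - m')\<^sup>2 / (8 * s\<^sup>2))"
  define B where "B = (c - c')\<^sup>2"
  have meas [measurable]: "p \<in> borel_measurable borel" "q \<in> borel_measurable borel" "t \<in> borel_measurable borel"
    by (auto simp: p_def q_def t_def)
  have pos: "p y > 0" "q y > 0" "t y > 0" for y
    using s by (auto simp: p_def q_def t_def normal_density_pos)
  have total: "(\<integral>\<^sup>+y. ennreal (normal_density a s y) \<partial>lborel) = 1" for a
    using s by (subst nn_integral_eq_integral) (auto simp: normal_density_nonneg)
  \<comment> \<open>The geometric mean of two normal densities is a multiple of the density centred at the midpoint,
    and the factor \<open>\<rho>\<close> is their Hellinger affinity.\<close>
  have tt: "\<rho> * t y = sqrt (p y * q y)" for y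
  proof -
    have "(\<rho> * t y)\<^sup>2 = p y * q y"
    proof -
      have e: "2 * (- (m - m')\<^sup>2 / (8 * s\<^sup>2)) + 2 * (- (y - (m + m') / 2)\<^sup>2 / (2 * s\<^sup>2))
        = - (y - m)\<^sup>2 / (2 * s\<^sup>2) + - (y - m')\<^sup>2 / (2 * s\<^sup>2)"
        using s by (simp add: field_simps power2_eq_square)
      have ex: "exp u ^ 2 = exp (2 * u)" for u :: real
        by (simp add: exp_double)
      show ?thesis
        unfolding p_def q_def t_def \<rho>_def normal_density_def power_mult_distrib ex
        using e by (simp add: power2_eq_square exp_add[symmetric] field_simps)
    qed
    moreover have "\<rho> * t y \<ge> 0" using pos[of y] by (simp add: \<rho>_def)
    ultimately show ?thesis by (metis real_sqrt_unique)
  qed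
  have rho_half: "\<rho>\<^sup>2 \<ge> 1/2"
  proof -
    have "(m - m')\<^sup>2 / (4 * s\<^sup>2) \<le> 1/2" using close s by (simp add: field_simps)
    moreover have "\<rho>\<^sup>2 = exp (- (m - m')\<^sup>2 / (4 * s\<^sup>2))"
      using s by (simp add: \<rho>_def exp_double[symmetric])
    moreover have "1 + - ((m - m')\<^sup>2 / (4 * s\<^sup>2)) \<le> exp (- ((m - m')\<^sup>2 / (4 * s\<^sup>2)))"
      by (rule exp_ge_add_one_self)
    ultimately show ?thesis by simp
  qed
  \<comment> \<open>The tangent bound with its negative term moved to the other side, so that all integrals are
    integrals of nonnegative functions.\<close>
  have pointwise: "B * \<rho> * (\<rho> * t y) \<le>
    (h y - c)\<^sup>2 * p y + (h y - c')\<^sup>2 * q y + B * \<rho>\<^sup>2 / 4 * (p y + q y)" for y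
  proof -
    define u v where "u = \<bar>h y - c\<bar>" and "v = \<bar>h y - c'\<bar>"
    define P Q where "P = sqrt (p y)" and "Q = sqrt (q y)"
    have PQ: "p y = P\<^sup>2" "q y = Q\<^sup>2" "\<rho> * t y = P * Q" "P > 0" "Q > 0"
      using pos[of y] by (auto simp: P_def Q_def tt real_sqrt_mult)
    have uv: "B \<le> (u + v)\<^sup>2"
      unfolding B_def u_def v_def by (rule abs_le_square_iff[THEN iffD1]) linarith
    have "P\<^sup>2 * Q\<^sup>2 * B \<le> P\<^sup>2 * Q\<^sup>2 * (u + v)\<^sup>2" by (intro mult_left_mono uv) simp
    also have "\<dots> \<le> (u\<^sup>2 * P\<^sup>2 + v\<^sup>2 * Q\<^sup>2) * (P\<^sup>2 + Q\<^sup>2)"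
    proof -
      have "(u\<^sup>2 * P\<^sup>2 + v\<^sup>2 * Q\<^sup>2) * (P\<^sup>2 + Q\<^sup>2) - P\<^sup>2 * Q\<^sup>2 * (u + v)\<^sup>2 = (u * P\<^sup>2 - v * Q\<^sup>2)\<^sup>2"
        by (simp add: power2_eq_square algebra_simps)
      then show ?thesis by (metis diff_ge_0_iff_ge zero_le_power2)
    qed
    finally have 1: "P\<^sup>2 * Q\<^sup>2 * B / (P\<^sup>2 + Q\<^sup>2) \<le> u\<^sup>2 * P\<^sup>2 + v\<^sup>2 * Q\<^sup>2"
      using PQ(4) by (simp add: pos_divide_le_eq add_pos_nonneg)
    have B0: "B \<ge> 0" by (simp add: B_def)
    have S: "P\<^sup>2 + Q\<^sup>2 > 0" using PQ(4) by (simp add: add_pos_nonneg)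
    have "B * (P * Q - \<rho> / 2 * (P\<^sup>2 + Q\<^sup>2))\<^sup>2 / (P\<^sup>2 + Q\<^sup>2) \<ge> 0"
      using B0 S by simp
    also have "B * (P * Q - \<rho> / 2 * (P\<^sup>2 + Q\<^sup>2))\<^sup>2 / (P\<^sup>2 + Q\<^sup>2)
      = P\<^sup>2 * Q\<^sup>2 * B / (P\<^sup>2 + Q\<^sup>2) - B * \<rho> * (P * Q) + B * \<rho>\<^sup>2 / 4 * (P\<^sup>2 + Q\<^sup>2)"
    proof -
      have gen: "B * (x - \<rho> / 2 * T)\<^sup>2 / T = x\<^sup>2 * B / T - B * \<rho> * x + B * \<rho>\<^sup>2 / 4 * T" if "T > 0" for x T :: real
        using that by (simp add: field_simps power2_eq_square)
      show ?thesis using gen[OF S, of "P * Q"] by (simp add: power_mult_distrib)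
    qed
    finally have "B * \<rho> * (P * Q) \<le> u\<^sup>2 * P\<^sup>2 + v\<^sup>2 * Q\<^sup>2 + B * \<rho>\<^sup>2 / 4 * (P\<^sup>2 + Q\<^sup>2)"
      using 1 by linarith
    then show ?thesis by (simp add: PQ u_def v_def)
  qed
  have law: "distributed M lborel (\<lambda>x. a + s * Z x) (normal_density a s)" for a
    using normal_density_affine[OF Z, of s a] s by simp
  have transfer: "(\<integral>\<^sup>+x. ennreal ((h (a + s * Z x) - e)\<^sup>2) \<partial>M) =
      (\<integral>\<^sup>+y. ennreal ((h y - e)\<^sup>2 * normal_density a s y) \<partial>lborel)" for a e
    by (subst distributed_nn_integral[OF law[of a], symmetric])
      (auto simp: ennreal_mult' mult.commute intro!: nn_integral_cong)
  define R where "R = (\<integral>\<^sup>+y. ennreal ((h y - c)\<^sup>2 * p y) \<partial>lborel) + (\<integral>\<^sup>+y. ennreal ((h y - c')\<^sup>2 * q y) \<partial>lborel)"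
  have B0: "B \<ge> 0" by (simp add: B_def)
  have "ennreal (B * \<rho>\<^sup>2) = ennreal (B * \<rho>\<^sup>2) * (\<integral>\<^sup>+y. ennreal (t y) \<partial>lborel)"
    by (simp add: t_def total)
  also have "\<dots> = (\<integral>\<^sup>+y. ennreal (B * \<rho> * (\<rho> * t y)) \<partial>lborel)"
    using B0 pos(3) by (subst nn_integral_cmult[symmetric])
      (auto simp: ennreal_mult'[symmetric] less_imp_le power2_eq_square ac_simps)
  also have "\<dots> \<le> (\<integral>\<^sup>+y. ennreal ((h y - c)\<^sup>2 * p y) + ennreal ((h y - c')\<^sup>2 * q y)
      + ennreal (B * \<rho>\<^sup>2 / 4) * (ennreal (p y) + ennreal (q y)) \<partial>lborel)"
  proof (rule nn_integral_mono)
    fix y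
    show "ennreal (B * \<rho> * (\<rho> * t y)) \<le> ennreal ((h y - c)\<^sup>2 * p y) + ennreal ((h y - c')\<^sup>2 * q y)
      + ennreal (B * \<rho>\<^sup>2 / 4) * (ennreal (p y) + ennreal (q y))"
      using pos[of y] B0 ennreal_leI[OF pointwise[of y]]
      by (simp add: ennreal_plus[symmetric] ennreal_mult'[symmetric] del: ennreal_plus)
  qed
  also have "\<dots> = R + ennreal (B * \<rho>\<^sup>2 / 4) * (1 + 1)"
    by (simp add: nn_integral_add nn_integral_cmult R_def p_def q_def total)
  also have "\<dots> = R + ennreal (B * \<rho>\<^sup>2 / 2)"
    using B0 ennreal_mult'[of 2 "B * \<rho>\<^sup>2 / 4"]
    by (simp add: mult.commute)
  finally have main: "ennreal (B * \<rho>\<^sup>2 / 2) + ennreal (B * \<rho>\<^sup>2 / 2) \<le> R + ennreal (B * \<rho>\<^sup>2 / 2)"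
    using B0 by (simp add: ennreal_plus[symmetric] del: ennreal_plus)
  then have "ennreal (B * \<rho>\<^sup>2 / 2) \<le> R"
    unfolding add.commute[of R] ennreal_add_left_cancel_le by simp
  moreover have "B / 4 \<le> B * \<rho>\<^sup>2 / 2"
    using mult_left_mono[OF rho_half B0] by simp
  ultimately have "ennreal (B / 4) \<le> R" by (meson ennreal_leI order_trans)
  then show ?thesis
    by (simp add: R_def transfer p_def q_def B_def)
qed

text \<open>Independence splits the law of the family as a product of the \<open>i\<close>-th marginal and the law of the
  other coordinates. Once the latter are fixed, both integrands are functions of \<open>W i\<close> alone, and the
  one-dimensional bound applies to each section.\<close>
lemma independent_shift_two_point:
  fixes W :: "'i \<Rightarrow> 'm \<Rightarrow> real" and g :: "('i \<Rightarrow> real) \<Rightarrow> real"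
  assumes M: "prob_space M" and ind: "prob_space.indep_vars M (\<lambda>_. borel) W I"
    and i: "i \<in> I" and Wi: "distributed M lborel (W i) std_normal_density"
    and g [measurable]: "g \<in> borel_measurable (PiM I (\<lambda>_. borel))"
    and agree: "\<And>j. j \<in> I \<Longrightarrow> j \<noteq> i \<Longrightarrow> \<mu> j = \<mu>' j"
    and s: "s i > 0" and close: "(\<mu> i - \<mu>' i)\<^sup>2 \<le> 2 * (s i)\<^sup>2"
  shows "ennreal ((c - c')\<^sup>2 / 4) \<le>
    (\<integral>\<^sup>+x. ennreal ((g (\<lambda>j\<in>I. \<mu> j + s j * W j x) - c)\<^sup>2) \<partial>M) +
    (\<integral>\<^sup>+x. ennreal ((g (\<lambda>j\<in>I. \<mu>' j + s j * W j x) - c')\<^sup>2) \<partial>M)"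
proof -
  interpret prob_space M by fact
  define N where "N j = distr M borel (W j)" for j
  define I' where "I' = I - {i}"
  have I: "I = insert i I'" "i \<notin> I'" using i by (auto simp: I'_def)
  have rv: "W j \<in> borel_measurable M" if "j \<in> I" for j
    using ind that unfolding indep_vars_def by auto
  have N: "prob_space (N j)" if "j \<in> I" for j
    unfolding N_def by (rule prob_space_distr) (rule rv[OF that])
  interpret Ni: prob_space "N i" using N i by blast
  interpret PI': prob_space "PiM I' N" by (rule prob_space_PiM) (auto intro: N simp: I'_def)
  interpret pair_sigma_finite "N i" "PiM I' N" ..
  have sets_N [measurable_cong]: "sets (N j) = sets borel" for j by (simp add: N_def)
  have sets_Pi: "sets (PiM J N) = sets (PiM J (\<lambda>_. borel))" for J
    by (intro sets_PiM_cong) (auto simp: sets_N)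
  have joint: "distr M (PiM I (\<lambda>_. borel)) (\<lambda>x. \<lambda>j\<in>I. W j x) = PiM I N"
    unfolding N_def using indep_vars_iff_distr_eq_PiM'[THEN iffD1, OF _ rv ind] i by auto
  have split: "distr (N i \<Otimes>\<^sub>M PiM I' N) (PiM I N) (\<lambda>(x, X). X(i := x)) = PiM I N"
    unfolding I(1) by (rule distr_pair_PiM_eq_PiM) (auto intro: N simp: I)
  \<comment> \<open>The loss with coordinate \<open>i\<close> split off. It can be written with \<open>\<mu>\<close> for both means, as they agree
    on the remaining coordinates.\<close>
  define F where "F m e X y = ennreal ((g (\<lambda>j\<in>I. if j = i then m + s i * y else \<mu> j + s j * X j) - e)\<^sup>2)"
    for m e X y
  have F_meas: "(\<lambda>(y, X). F m e X y) \<in> borel_measurable (N i \<Otimes>\<^sub>M PiM I' N)" for m e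
  proof -
    have "(\<lambda>(y, X). \<lambda>j\<in>I. if j = i then m + s i * y else \<mu> j + s j * X j)
        \<in> measurable (borel \<Otimes>\<^sub>M PiM I' (\<lambda>_. borel)) (PiM I (\<lambda>_. borel))"
      unfolding case_prod_beta
    proof (rule measurable_restrict)
      fix j assume "j \<in> I"
      then have "j = i \<or> j \<in> I'" by (auto simp: I)
      then show "(\<lambda>x. if j = i then m + s i * fst x else \<mu> j + s j * snd x j)
          \<in> borel_measurable (borel \<Otimes>\<^sub>M PiM I' (\<lambda>_. borel))"
        by (cases "j = i") auto
    qed
    then have *: "(\<lambda>p. ennreal ((g ((\<lambda>(y, X). \<lambda>j\<in>I. if j = i then m + s i * y else \<mu> j + s j * X j) p) - e)\<^sup>2))
        \<in> borel_measurable (borel \<Otimes>\<^sub>M PiM I' (\<lambda>_. borel))"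
      by measurable
    have "sets (N i \<Otimes>\<^sub>M PiM I' N) = sets (borel \<Otimes>\<^sub>M PiM I' (\<lambda>_. borel))"
      by (rule sets_pair_measure_cong) (simp_all add: sets_N sets_Pi)
    then show ?thesis
      using * by (simp add: F_def case_prod_beta cong: measurable_cong_sets)
  qed
  have rewrite: "(\<integral>\<^sup>+x. ennreal ((g (\<lambda>j\<in>I. m j + s j * W j x) - e)\<^sup>2) \<partial>M)
      = (\<integral>\<^sup>+X. \<integral>\<^sup>+y. F (m i) e X y \<partial>N i \<partial>PiM I' N)"
    if eq: "\<And>j. j \<in> I \<Longrightarrow> j \<noteq> i \<Longrightarrow> m j = \<mu> j" for m e
  proof -
    define G where "G w = ennreal ((g (\<lambda>j\<in>I. m j + s j * w j) - e)\<^sup>2)" for w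
    have shift: "(\<lambda>w. \<lambda>j\<in>I. m j + s j * w j) \<in> measurable (PiM I (\<lambda>_. borel)) (PiM I (\<lambda>_. borel))"
      by (rule measurable_restrict) measurable
    have G [measurable]: "G \<in> borel_measurable (PiM I (\<lambda>_. borel))"
      unfolding G_def using shift by measurable
    have W_meas: "(\<lambda>x. \<lambda>j\<in>I. W j x) \<in> measurable M (PiM I (\<lambda>_. borel))"
      by (rule measurable_restrict) (rule rv)
    have GN: "G \<in> borel_measurable (PiM I N)"
      using G by (simp add: sets_Pi cong: measurable_cong_sets)
    have "(\<integral>\<^sup>+x. ennreal ((g (\<lambda>j\<in>I. m j + s j * W j x) - e)\<^sup>2) \<partial>M)
        = (\<integral>\<^sup>+x. G (\<lambda>j\<in>I. W j x) \<partial>M)"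
    proof (rule nn_integral_cong)
      fix x
      have "(\<lambda>j\<in>I. m j + s j * W j x) = (\<lambda>j\<in>I. m j + s j * (\<lambda>j\<in>I. W j x) j)"
        by (simp add: fun_eq_iff)
      then show "ennreal ((g (\<lambda>j\<in>I. m j + s j * W j x) - e)\<^sup>2) = G (\<lambda>j\<in>I. W j x)"
        unfolding G_def by (rule arg_cong)
    qed
    also have "\<dots> = (\<integral>\<^sup>+w. G w \<partial>PiM I N)"
      unfolding joint[symmetric] by (rule nn_integral_distr[OF W_meas, symmetric]) (simp add: G)
    also have "\<dots> = (\<integral>\<^sup>+p. G ((\<lambda>(x, X). X(i := x)) p) \<partial>(N i \<Otimes>\<^sub>M PiM I' N))"
    proof -
      have "(\<lambda>(x, X). X(i := x)) \<in> measurable (N i \<Otimes>\<^sub>M PiM I' N) (PiM I N)"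
        unfolding case_prod_beta by (rule measurable_fun_upd[where J=I']) (auto simp: I)
      from nn_integral_distr[OF this, of G] show ?thesis
        unfolding split using GN by simp
    qed
    also have "\<dots> = (\<integral>\<^sup>+p. (\<lambda>(y, X). F (m i) e X y) p \<partial>(N i \<Otimes>\<^sub>M PiM I' N))"
    proof (rule nn_integral_cong)
      fix p
      have "(\<lambda>j\<in>I. m j + s j * ((snd p)(i := fst p)) j)
          = (\<lambda>j\<in>I. if j = i then m i + s i * fst p else \<mu> j + s j * snd p j)"
        using eq by (auto simp: fun_eq_iff)
      then show "G ((\<lambda>(x, X). X(i := x)) p) = (\<lambda>(y, X). F (m i) e X y) p"
        by (simp add: G_def F_def case_prod_beta)
    qed
    also have "\<dots> = (\<integral>\<^sup>+X. \<integral>\<^sup>+y. F (m i) e X y \<partial>N i \<partial>PiM I' N)"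
      using nn_integral_snd[OF F_meas[of "m i" e]] by simp
    finally show ?thesis .
  qed
  have F_int: "(\<integral>\<^sup>+y. F a e X y \<partial>N i) = (\<integral>\<^sup>+x. F a e X (W i x) \<partial>M)"
    if X: "X \<in> space (PiM I' N)" for a e X
  proof -
    have "F a e X \<in> borel_measurable (N i)"
      using measurable_compose[OF measurable_Pair2'[OF X, of "N i"] F_meas[of a e]] by simp
    then show ?thesis
      using rv[OF i] sets_N by (simp add: N_def nn_integral_distr)
  qed
  have "ennreal ((c - c')\<^sup>2 / 4) = (\<integral>\<^sup>+X. ennreal ((c - c')\<^sup>2 / 4) \<partial>PiM I' N)"
    by (simp add: PI'.emeasure_space_1)
  also have "\<dots> \<le> (\<integral>\<^sup>+X. (\<integral>\<^sup>+y. F (\<mu> i) c X y \<partial>N i) + (\<integral>\<^sup>+y. F (\<mu>' i) c' X y \<partial>N i) \<partial>PiM I' N)"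
  proof (rule nn_integral_mono)
    fix X assume X: "X \<in> space (PiM I' N)"
    define h where "h y = g (\<lambda>j\<in>I. if j = i then y else \<mu> j + s j * X j)" for y
    have "(\<lambda>y. \<lambda>j\<in>I. if j = i then y else \<mu> j + s j * X j) \<in> measurable borel (PiM I (\<lambda>_. borel))"
      by (rule measurable_restrict) simp
    then have "h \<in> borel_measurable borel" unfolding h_def by measurable
    from gaussian_shift_two_point[OF M Wi this s close, of c c']
    show "ennreal ((c - c')\<^sup>2 / 4) \<le> (\<integral>\<^sup>+y. F (\<mu> i) c X y \<partial>N i) + (\<integral>\<^sup>+y. F (\<mu>' i) c' X y \<partial>N i)"
      unfolding F_int[OF X] by (simp add: h_def F_def)
  qed
  also have "\<dots> = (\<integral>\<^sup>+X. \<integral>\<^sup>+y. F (\<mu> i) c X y \<partial>N i \<partial>PiM I' N) + (\<integral>\<^sup>+X. \<integral>\<^sup>+y. F (\<mu>' i) c' X y \<partial>N i \<partial>PiM I' N)"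
  proof (rule nn_integral_add)
    have "(\<lambda>X. \<integral>\<^sup>+y. F a e X y \<partial>N i) \<in> borel_measurable (PiM I' N)" for a e
      using Ni.borel_measurable_nn_integral[of "F a e" "PiM I' N"] measurable_pair_swap[OF F_meas[of a e]]
      by (simp add: case_prod_beta)
    then show "(\<lambda>X. \<integral>\<^sup>+y. F (\<mu> i) c X y \<partial>N i) \<in> borel_measurable (PiM I' N)"
      "(\<lambda>X. \<integral>\<^sup>+y. F (\<mu>' i) c' X y \<partial>N i) \<in> borel_measurable (PiM I' N)" by auto
  qed
  also have "\<dots> = (\<integral>\<^sup>+x. ennreal ((g (\<lambda>j\<in>I. \<mu> j + s j * W j x) - c)\<^sup>2) \<partial>M) +
    (\<integral>\<^sup>+x. ennreal ((g (\<lambda>j\<in>I. \<mu>' j + s j * W j x) - c')\<^sup>2) \<partial>M)"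
    using agree by (simp add: rewrite)
  finally show ?thesis .
qed

section \<open>Averaging over a hypercube\<close>

text \<open>Subsets \<open>\<theta>\<close> of \<open>J\<close> stand for the vertices of a hypercube. For fixed \<open>j\<close>, the edges from \<open>\<theta>\<close> to
  \<open>insert j \<theta>\<close> partition the vertices into pairs, so the average of \<open>r j\<close> over all vertices is at
  least \<open>v j\<close>; and a uniform upper bound for the sums over \<open>j\<close> bounds the sum of these averages.\<close>
lemma assouad_pairing:
  fixes r :: "'a \<Rightarrow> 'a set \<Rightarrow> ennreal"
  assumes J: "finite J"
    and bound: "\<And>\<theta>. \<theta> \<subseteq> J \<Longrightarrow> (\<Sum>j\<in>J. r j \<theta>) \<le> S"
    and v: "\<And>j. j \<in> J \<Longrightarrow> v j \<ge> 0"
    and pair: "\<And>j \<theta>. j \<in> J \<Longrightarrow> \<theta> \<subseteq> J - {j} \<Longrightarrow> ennreal (2 * v j) \<le> r j \<theta> + r j (insert j \<theta>)"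
  shows "ennreal (\<Sum>j\<in>J. v j) \<le> S"
proof -
  have one: "2 ^ card J * ennreal (v j) \<le> (\<Sum>\<theta>\<in>Pow J. r j \<theta>)" if j: "j \<in> J" for j
  proof -
    define K where "K = J - {j}"
    have K: "J = insert j K" "j \<notin> K" "finite K" using j J by (auto simp: K_def)
    have inj: "inj_on (insert j) (Pow K)" using K(2) by (auto simp: inj_on_def)
    have "2 ^ card J * ennreal (v j) = (\<Sum>\<theta>\<in>Pow K. ennreal (2 * v j))"
      using K v[OF j] by (simp add: card_Pow ennreal_mult mult.assoc mult.left_commute)
    also have "\<dots> \<le> (\<Sum>\<theta>\<in>Pow K. r j \<theta> + r j (insert j \<theta>))"
      by (intro sum_mono pair j) (auto simp: K_def)
    also have "\<dots> = (\<Sum>\<theta>\<in>Pow K. r j \<theta>) + (\<Sum>\<theta>\<in>insert j ` Pow K. r j \<theta>)"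
      by (simp add: sum.distrib sum.reindex[OF inj])
    also have "\<dots> = (\<Sum>\<theta>\<in>Pow J. r j \<theta>)"
      unfolding K(1) Pow_insert using K(2,3) by (subst sum.union_disjoint) auto
    finally show ?thesis .
  qed
  have "2 ^ card J * ennreal (\<Sum>j\<in>J. v j) = (\<Sum>j\<in>J. 2 ^ card J * ennreal (v j))"
    using v by (simp add: sum_distrib_left[symmetric] sum_ennreal)
  also have "\<dots> \<le> (\<Sum>j\<in>J. \<Sum>\<theta>\<in>Pow J. r j \<theta>)" by (intro sum_mono one)
  also have "\<dots> = (\<Sum>\<theta>\<in>Pow J. \<Sum>j\<in>J. r j \<theta>)" by (rule sum.swap)
  also have "\<dots> \<le> (\<Sum>\<theta>\<in>Pow J. S)" by (intro sum_mono bound) auto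
  also have "\<dots> = 2 ^ card J * S" using J by (simp add: card_Pow)
  finally show ?thesis
    by (subst (asm) ennreal_mult_le_mult_iff) (auto simp: power_eq_top_ennreal)
qed

section \<open>Compact operators with prescribed singular values\<close>

lemma inner_orthonormal_sum:
  assumes e: "orthonormal_system e" and J: "finite J" "J \<subseteq> {1..}" and i: "i \<ge> 1"
  shows "(\<Sum>j\<in>J. c j *\<^sub>R e j) \<bullet> e i = (if i \<in> J then c i else 0)"
proof -
  have "(\<Sum>j\<in>J. c j *\<^sub>R e j) \<bullet> e i = (\<Sum>j\<in>J. if i = j then c j else 0)"
    unfolding inner_sum_left using e J(2) i
    by (intro sum.cong) (auto simp: orthonormal_system_def)
  then show ?thesis using J(1) by simp
qed

lemma norm_orthonormal_sum:
  assumes e: "orthonormal_system e" and J: "finite J" "J \<subseteq> {1..}"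
  shows "(norm (\<Sum>j\<in>J. c j *\<^sub>R e j))\<^sup>2 = (\<Sum>j\<in>J. (c j)\<^sup>2)"
proof -
  have "(norm (\<Sum>j\<in>J. c j *\<^sub>R e j))\<^sup>2 = (\<Sum>i\<in>J. (\<Sum>j\<in>J. c j *\<^sub>R e j) \<bullet> (c i *\<^sub>R e i))"
    unfolding power2_norm_eq_inner by (rule inner_sum_right)
  also have "\<dots> = (\<Sum>j\<in>J. (c j)\<^sup>2)"
    using J by (intro sum.cong) (auto simp: inner_orthonormal_sum[OF e J] power2_eq_square)
  finally show ?thesis .
qed

lemma bessel_inequality:
  assumes e: "orthonormal_system e" and J: "finite J" "J \<subseteq> {1..}"
  shows "(\<Sum>j\<in>J. (h \<bullet> e j)\<^sup>2) \<le> (norm h)\<^sup>2"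
proof -
  define P where "P = (\<Sum>j\<in>J. (h \<bullet> e j) *\<^sub>R e j)"
  have hP: "h \<bullet> P = (\<Sum>j\<in>J. (h \<bullet> e j)\<^sup>2)"
    by (simp add: P_def inner_sum_right power2_eq_square)
  have PP: "P \<bullet> P = (\<Sum>j\<in>J. (h \<bullet> e j)\<^sup>2)"
    unfolding P_def using norm_orthonormal_sum[OF e J] by (simp add: power2_norm_eq_inner)
  have "0 \<le> (h - P) \<bullet> (h - P)" by simp
  also have "\<dots> = (norm h)\<^sup>2 - (\<Sum>j\<in>J. (h \<bullet> e j)\<^sup>2)"
    using hP PP by (simp add: inner_diff inner_commute[of P h] power2_norm_eq_inner)
  finally show ?thesis by simp
qed

text \<open>Uniformity in \<open>m\<close> is what matters: it gives the Cauchy property of the partial sums as well as the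
  operator norm bound for the remainder.\<close>
lemma norm_diagonal_tail:
  assumes \<phi>: "orthonormal_system \<phi>" and \<psi>: "orthonormal_system \<psi>"
    and e: "e \<ge> 0" "\<And>j. j > n \<Longrightarrow> \<bar>a j\<bar> \<le> e"
  shows "norm (\<Sum>j\<in>{n<..m}. (a j * (h \<bullet> \<phi> j)) *\<^sub>R \<psi> j) \<le> e * norm h"
proof (rule power2_le_imp_le)
  have J: "finite {n<..m}" "{n<..m} \<subseteq> {1..}" by auto
  have "(norm (\<Sum>j\<in>{n<..m}. (a j * (h \<bullet> \<phi> j)) *\<^sub>R \<psi> j))\<^sup>2 = (\<Sum>j\<in>{n<..m}. (a j)\<^sup>2 * (h \<bullet> \<phi> j)\<^sup>2)"
    by (simp add: norm_orthonormal_sum[OF \<psi> J] power_mult_distrib)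
  also have "\<dots> \<le> (\<Sum>j\<in>{n<..m}. e\<^sup>2 * (h \<bullet> \<phi> j)\<^sup>2)"
    using e by (intro sum_mono mult_right_mono) (auto simp: abs_le_square_iff[symmetric])
  also have "\<dots> \<le> e\<^sup>2 * (norm h)\<^sup>2"
    unfolding sum_distrib_left[symmetric] by (intro mult_left_mono bessel_inequality[OF \<phi> J]) simp
  finally show "(norm (\<Sum>j\<in>{n<..m}. (a j * (h \<bullet> \<phi> j)) *\<^sub>R \<psi> j))\<^sup>2 \<le> (e * norm h)\<^sup>2"
    by (simp add: power_mult_distrib)
qed (use e in simp)

text \<open>The truncated operators map the unit ball into such a box, for which compactness follows coordinate
  by coordinate.\<close>
lemma box_sum_subset_compact:
  fixes \<psi> :: "nat \<Rightarrow> 'g::real_normed_vector"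
  shows "\<exists>K. compact K \<and> (\<forall>c. (\<forall>j\<in>{1..n}. \<bar>c j\<bar> \<le> B) \<longrightarrow> (\<Sum>j=1..n. c j *\<^sub>R \<psi> j) \<in> K)"
proof (induction n)
  case 0
  show ?case by (rule exI[of _ "{0}"]) simp
next
  case (Suc n)
  then obtain K where K: "compact K" "\<And>c. \<forall>j\<in>{1..n}. \<bar>c j\<bar> \<le> B \<Longrightarrow> (\<Sum>j=1..n. c j *\<^sub>R \<psi> j) \<in> K"
    by blast
  define L where "L = (\<lambda>t. t *\<^sub>R \<psi> (Suc n)) ` {-B..B}"
  have "compact L" unfolding L_def by (intro compact_continuous_image continuous_intros) simp
  then have "compact {x + y | x y. x \<in> K \<and> y \<in> L}" by (intro compact_sums K)
  moreover have "(\<Sum>j=1..Suc n. c j *\<^sub>R \<psi> j) \<in> {x + y | x y. x \<in> K \<and> y \<in> L}"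
    if c: "\<forall>j\<in>{1..Suc n}. \<bar>c j\<bar> \<le> B" for c
  proof -
    have "c (Suc n) \<in> {-B..B}" using c[rule_format, of "Suc n"] by (simp add: abs_le_iff)
    then have "c (Suc n) *\<^sub>R \<psi> (Suc n) \<in> L" by (auto simp: L_def)
    moreover have "(\<Sum>j=1..n. c j *\<^sub>R \<psi> j) \<in> K" using c by (intro K(2)) auto
    ultimately show ?thesis by auto
  qed
  ultimately show ?case by blast
qed

text \<open>A finite net of a compact set close to \<open>A\<close> is, with a larger
  radius, also a net of \<open>A\<close> and of its closure.\<close>
lemma compact_closure_of_approximation:
  fixes A :: "'g::{real_normed_vector, polish_space} set"
  assumes "\<And>e. e > 0 \<Longrightarrow> \<exists>K. compact K \<and> (\<forall>x\<in>A. \<exists>y\<in>K. dist x y \<le> e)"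
  shows "compact (closure A)"
  unfolding compact_eq_totally_bounded
proof (intro conjI allI impI)
  show "Topological_Spaces.complete (closure A)" by (simp add: complete_eq_closed)
  fix e :: real assume e: "e > 0"
  then obtain K where K: "compact K" "\<And>x. x \<in> A \<Longrightarrow> \<exists>y\<in>K. dist x y \<le> e / 4"
    using assms[of "e/4"] by auto
  from K(1)[unfolded compact_eq_totally_bounded] e
  obtain F where F: "finite F" "K \<subseteq> (\<Union>x\<in>F. ball x (e/4))" by (metis zero_less_divide_iff zero_less_numeral)
  have "closure A \<subseteq> (\<Union>x\<in>F. ball x e)"
  proof
    fix x assume "x \<in> closure A"
    then obtain x' where x': "x' \<in> A" "dist x' x < e / 4"
      using e by (metis closure_approachable zero_less_divide_iff zero_less_numeral)
    obtain y where y: "y \<in> K" "dist x' y \<le> e / 4" using K(2)[OF x'(1)] by blast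
    obtain z where z: "z \<in> F" "dist z y < e / 4" using F(2) y(1) by (auto simp: subset_iff)
    have "dist z x \<le> dist z y + dist x' y + dist x' x"
      by (metis add_mono_thms_linordered_semiring(3) dist_commute dist_triangle dist_triangle_le)
    then have "dist z x < e" using x' y z e by linarith
    then show "x \<in> (\<Union>x\<in>F. ball x e)" using z(1) by auto
  qed
  then show "\<exists>k. finite k \<and> closure A \<subseteq> (\<Union>x\<in>k. ball x e)" using F(1) by blast
qed

text \<open>By Bessel's inequality, the partial sums of \<open>\<Sum>j. a\<^sub>j \<langle>h, \<phi>\<^sub>j\<rangle> \<psi>\<^sub>j\<close> converge uniformly on the unit ball
  because \<open>a\<^sub>j \<rightarrow> 0\<close>. The limit is thus bounded, and compact as a norm limit of finite-rank operators.\<close>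
lemma diagonal_operator_exists:
  fixes \<phi> :: "nat \<Rightarrow> 'h::real_inner" and \<psi> :: "nat \<Rightarrow> 'g::{real_inner, polish_space}"
  assumes \<phi>: "orthonormal_system \<phi>" and \<psi>: "orthonormal_system \<psi>"
    and pos: "\<And>j. j \<ge> 1 \<Longrightarrow> a j > 0" and lim: "a \<longlonglongrightarrow> 0"
  shows "\<exists>T\<in>op_class \<phi> \<psi>. \<forall>j\<ge>1. sing_val \<phi> \<psi> T j = a j"
proof -
  define S where "S n h = (\<Sum>j=1..n. (a j * (h \<bullet> \<phi> j)) *\<^sub>R \<psi> j)" for n h
  define T where "T h = lim (\<lambda>n. S n h)" for h
  have S_diff: "S m h - S n h = (\<Sum>j\<in>{n<..m}. (a j * (h \<bullet> \<phi> j)) *\<^sub>R \<psi> j)" if "n \<le> m" for m n h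
  proof -
    have "{1..m} = {1..n} \<union> {n<..m}" "{1..n} \<inter> {n<..m} = {}" using that by auto
    then show ?thesis by (simp add: S_def sum.union_disjoint)
  qed
  have small: "\<exists>n. \<forall>j>n. \<bar>a j\<bar> \<le> e" if "e > 0" for e
    using LIMSEQ_D[OF lim that] by (auto intro: less_imp_le dest: less_imp_le)
  have S_close: "norm (S m h - S n h) \<le> e * norm h"
    if "n \<le> m" "e \<ge> 0" "\<And>j. j > n \<Longrightarrow> \<bar>a j\<bar> \<le> e" for m n h e
    unfolding S_diff[OF that(1)] by (rule norm_diagonal_tail[OF \<phi> \<psi> that(2,3)])
  have "Cauchy (\<lambda>n. S n h)" for h
  proof (rule CauchyI')
    fix e :: real assume e: "e > 0"
    define e' where "e' = e / (norm h + 1)"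
    have e': "e' > 0" using e by (simp add: e'_def add_nonneg_pos)
    then obtain N where N: "\<And>j. j > N \<Longrightarrow> \<bar>a j\<bar> \<le> e'" using small by blast
    have "e' * (norm h + 1) = e" unfolding e'_def using norm_ge_zero[of h] by (simp add: add_nonneg_eq_0_iff)
    then have lt: "e' * norm h < e" using e' by (simp add: algebra_simps)
    show "\<exists>M. \<forall>m\<ge>M. \<forall>n>m. dist (S m h) (S n h) < e"
    proof (intro exI[of _ N] allI impI)
      fix m n assume "N \<le> m" "m < n"
      then have "norm (S n h - S m h) \<le> e' * norm h" using e' N by (intro S_close) auto
      then show "dist (S m h) (S n h) < e" using lt by (simp add: dist_norm norm_minus_commute)
    qed
  qed
  then have S_lim: "(\<lambda>n. S n h) \<longlonglongrightarrow> T h" for h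
    unfolding T_def by (simp add: Cauchy_convergent convergent_LIMSEQ_iff[symmetric])
  have T_close: "norm (T h - S n h) \<le> e * norm h"
    if "e \<ge> 0" "\<And>j. j > n \<Longrightarrow> \<bar>a j\<bar> \<le> e" for n h e
  proof (rule Lim_norm_ubound)
    show "(\<lambda>m. S m h - S n h) \<longlonglongrightarrow> T h - S n h" by (intro tendsto_intros S_lim)
    show "\<forall>\<^sub>F m in sequentially. norm (S m h - S n h) \<le> e * norm h"
      by (intro eventually_sequentiallyI[of n] S_close that)
  qed simp
  obtain B where B: "B > 0" "\<And>j. \<bar>a j\<bar> \<le> B"
    using convergent_imp_Bseq[OF convergentI[OF lim]] by (auto simp: Bseq_def)
  have bl: "bounded_linear T"
  proof (rule bounded_linear_intro)
    fix x y and c :: real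
    have "(\<lambda>n. S n x + S n y) \<longlonglongrightarrow> T x + T y" by (intro tendsto_intros S_lim)
    moreover have "S n x + S n y = S n (x + y)" for n
      by (simp add: S_def inner_add_left algebra_simps sum.distrib)
    ultimately show "T (x + y) = T x + T y" using S_lim[of "x + y"] LIMSEQ_unique by simp
    have "(\<lambda>n. c *\<^sub>R S n x) \<longlonglongrightarrow> c *\<^sub>R T x" by (intro tendsto_intros S_lim)
    moreover have "c *\<^sub>R S n x = S n (c *\<^sub>R x)" for n
      by (simp add: S_def scaleR_sum_right ac_simps)
    ultimately show "T (c *\<^sub>R x) = c *\<^sub>R T x" using S_lim[of "c *\<^sub>R x"] LIMSEQ_unique by simp
    show "norm (T x) \<le> norm x * B" using T_close[of B 0 x] B by (simp add: S_def mult.commute)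
  qed
  have T\<phi>: "T (\<phi> j) = a j *\<^sub>R \<psi> j" if j: "j \<ge> 1" for j
  proof -
    have "S n (\<phi> j) = a j *\<^sub>R \<psi> j" if "n \<ge> j" for n
    proof -
      have "S n (\<phi> j) = (\<Sum>i=1..n. if i = j then a j *\<^sub>R \<psi> j else 0)"
        unfolding S_def using \<phi> j by (intro sum.cong) (auto simp: orthonormal_system_def)
      then show ?thesis using j that by simp
    qed
    then have "(\<lambda>n. S n (\<phi> j)) \<longlonglongrightarrow> a j *\<^sub>R \<psi> j"
      by (intro tendsto_eventually eventually_sequentiallyI)
    then show ?thesis using S_lim LIMSEQ_unique by blast
  qed
  have "compact (closure (T ` ball 0 1))"
  proof (rule compact_closure_of_approximation)
    fix e :: real assume e: "e > 0"
    then obtain n where n: "\<And>j. j > n \<Longrightarrow> \<bar>a j\<bar> \<le> e" using small by blast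
    obtain K where K: "compact K" "\<And>c. \<forall>j\<in>{1..n}. \<bar>c j\<bar> \<le> B \<Longrightarrow> (\<Sum>j=1..n. c j *\<^sub>R \<psi> j) \<in> K"
      using box_sum_subset_compact[of n B \<psi>] by blast
    have "S n h \<in> K \<and> dist (T h) (S n h) \<le> e" if h: "norm h < 1" for h
    proof
      have "\<bar>a j * (h \<bullet> \<phi> j)\<bar> \<le> B" if "j \<ge> 1" for j
      proof -
        have "norm (\<phi> j) = 1" using \<phi> that by (simp add: orthonormal_system_def norm_eq_1)
        then have "\<bar>h \<bullet> \<phi> j\<bar> \<le> 1" using Cauchy_Schwarz_ineq2[of h "\<phi> j"] h by simp
        then show ?thesis using mult_mono[OF B(2)[of j], of "\<bar>h \<bullet> \<phi> j\<bar>" 1] B(1) by (simp add: abs_mult)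
      qed
      then show "S n h \<in> K" unfolding S_def by (intro K(2)) auto
      have "norm (T h - S n h) \<le> e * norm h" using e n by (intro T_close) auto
      also have "\<dots> \<le> e" using e h by (simp add: mult_left_le)
      finally show "dist (T h) (S n h) \<le> e" by (simp add: dist_norm)
    qed
    then show "\<exists>K. compact K \<and> (\<forall>x\<in>T ` ball 0 1. \<exists>y\<in>K. dist x y \<le> e)"
      using K(1) by (metis imageE mem_ball_0)
  qed
  then have "T \<in> op_class \<phi> \<psi>"
    unfolding op_class_def compact_operator_def using bl T\<phi> pos by auto
  moreover have "sing_val \<phi> \<psi> T j = a j" if "j \<ge> 1" for j
    using that \<psi> by (simp add: sing_val_def T\<phi> orthonormal_system_def)
  ultimately show ?thesis by blast
qed

text \<open>The upper bound by \<open>d\<close> forces \<open>a\<^sub>j \<le> \<surd>(d \<lambda>\<^sub>j) \<rightarrow> 0\<close>, which is what compactness needs.\<close>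
lemma link_class_contains:
  fixes \<phi> :: "nat \<Rightarrow> 'h::real_inner" and \<psi> :: "nat \<Rightarrow> 'g::{real_inner, polish_space}"
  assumes \<phi>: "orthonormal_system \<phi>" and \<psi>: "orthonormal_system \<psi>"
    and lam: "lam \<longlonglongrightarrow> 0" "\<And>j. j \<ge> 1 \<Longrightarrow> lam j > 0"
    and a: "\<And>j. j \<ge> 1 \<Longrightarrow> a j > 0" "\<And>j. j \<ge> 1 \<Longrightarrow> 1 / d \<le> (a j)\<^sup>2 / lam j"
      "\<And>j. j \<ge> 1 \<Longrightarrow> (a j)\<^sup>2 / lam j \<le> d"
  shows "\<exists>T\<in>link_class \<phi> \<psi> lam d. \<forall>j\<ge>1. sing_val \<phi> \<psi> T j = a j"
proof -
  have "a \<longlonglongrightarrow> 0"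
  proof (rule tendsto_sandwich)
    show "\<forall>\<^sub>F j in sequentially. 0 \<le> a j"
      using eventually_ge_at_top[of 1] by eventually_elim (use a in \<open>auto intro: less_imp_le\<close>)
    show "\<forall>\<^sub>F j in sequentially. a j \<le> sqrt (d * lam j)"
      using eventually_ge_at_top[of 1]
      by eventually_elim (use a(3) lam(2) in \<open>auto intro!: real_le_rsqrt simp: pos_divide_le_eq\<close>)
    show "(\<lambda>j. sqrt (d * lam j)) \<longlonglongrightarrow> 0"
      using tendsto_real_sqrt[OF tendsto_mult_right_zero[OF lam(1), of d]] by simp
  qed simp
  then obtain T where "T \<in> op_class \<phi> \<psi>" "\<forall>j\<ge>1. sing_val \<phi> \<psi> T j = a j"
    using diagonal_operator_exists[OF \<phi> \<psi>, of a] a(1) by blast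
  then show ?thesis
    using a(2,3) by (intro bexI[of _ T]) (simp_all add: link_class_def)
qed

section \<open>Lower bounds for the risk\<close>

text \<open>The means of all observations as one family: \<open>Inl j\<close> stands for \<open>Y\<^sub>j\<close> and \<open>Inr j\<close> for \<open>X\<^sub>j\<close>, in
  accordance with the index set of the noise.\<close>
definition mean_vec ::
  "(nat \<Rightarrow> 'h::real_inner) \<Rightarrow> (nat \<Rightarrow> 'g::real_inner) \<Rightarrow> 'h \<Rightarrow> ('h \<Rightarrow> 'g) \<Rightarrow> nat + nat \<Rightarrow> real" where
  "mean_vec \<phi> \<psi> f T = case_sum (\<lambda>j. sing_val \<phi> \<psi> T j * coef \<phi> f j) (sing_val \<phi> \<psi> T)"

definition coord_loss ::
  "'m measure \<Rightarrow> (nat \<Rightarrow> 'm \<Rightarrow> real) \<Rightarrow> (nat \<Rightarrow> 'm \<Rightarrow> real)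
    \<Rightarrow> (nat \<Rightarrow> 'h::real_inner) \<Rightarrow> (nat \<Rightarrow> 'g::real_inner) \<Rightarrow> real \<Rightarrow> real
    \<Rightarrow> ((nat \<Rightarrow> real) \<times> (nat \<Rightarrow> real) \<Rightarrow> 'h) \<Rightarrow> 'h \<Rightarrow> ('h \<Rightarrow> 'g) \<Rightarrow> nat \<Rightarrow> ennreal" where
  "coord_loss M \<xi> \<zeta> \<phi> \<psi> \<epsilon> \<sigma> est f T j =
    (\<integral>\<^sup>+x. ennreal ((coef \<phi> (est (obs_X \<phi> \<psi> \<zeta> \<sigma> T x, obs_Y \<phi> \<psi> \<xi> \<epsilon> f T x)) j - coef \<phi> f j)\<^sup>2) \<partial>M)"

lemma noise_measurable:
  assumes "iid_std_normal_noise M \<xi> \<zeta>" "j \<ge> 1"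
  shows "\<xi> j \<in> borel_measurable M" "\<zeta> j \<in> borel_measurable M"
  using assms by (auto simp: iid_std_normal_noise_def distributed_def)

lemma observation_measurable:
  assumes noise: "iid_std_normal_noise M \<xi> \<zeta>"
  shows "(\<lambda>x. (obs_X \<phi> \<psi> \<zeta> \<sigma> T x, obs_Y \<phi> \<psi> \<xi> \<epsilon> f T x))
    \<in> measurable M (PiM {1..} (\<lambda>_. borel) \<Otimes>\<^sub>M PiM {1..} (\<lambda>_. borel))"
  unfolding obs_X_def obs_Y_def
  by (intro measurable_Pair measurable_restrict borel_measurable_add borel_measurable_const
      borel_measurable_times noise_measurable[OF noise]) auto

lemma coef_measurable [measurable]: "(\<lambda>h. coef \<phi> h j) \<in> borel_measurable borel"
  unfolding coef_def by (intro borel_measurable_continuous_onI continuous_intros)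

lemma wnorm_sq_ge_partial_sum:
  assumes "finite J" "J \<subseteq> {1..}"
  shows "(\<Sum>j\<in>J. ennreal (w j * \<bar>coef \<phi> h j\<bar>\<^sup>2)) \<le> wnorm_sq \<phi> w h"
proof -
  have "(\<Sum>j\<in>J. ennreal (w j * \<bar>coef \<phi> h j\<bar>\<^sup>2)) = (\<Sum>\<^sub>\<infinity>j\<in>J. ennreal (w j * \<bar>coef \<phi> h j\<bar>\<^sup>2))"
    using assms(1) by simp
  also have "\<dots> \<le> wnorm_sq \<phi> w h"
    unfolding wnorm_sq_def using assms
    by (intro infsum_mono_neutral nonneg_summable_on_complete) auto
  finally show ?thesis .
qed

lemma risk_ge_coordinate_losses:
  assumes noise: "iid_std_normal_noise M \<xi> \<zeta>" and est: "est \<in> estimators"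
    and J: "finite J" "J \<subseteq> {1..}" and \<omega>: "\<And>j. j \<in> J \<Longrightarrow> \<omega> j \<ge> 0"
  shows "(\<Sum>j\<in>J. ennreal (\<omega> j) * coord_loss M \<xi> \<zeta> \<phi> \<psi> \<epsilon> \<sigma> est f T j)
    \<le> risk M \<xi> \<zeta> \<phi> \<psi> \<omega> \<epsilon> \<sigma> est f T"
proof -
  define E where "E x = est (obs_X \<phi> \<psi> \<zeta> \<sigma> T x, obs_Y \<phi> \<psi> \<xi> \<epsilon> f T x)" for x
  have [measurable]: "E \<in> borel_measurable M"
    unfolding E_def using measurable_compose[OF observation_measurable[OF noise] est[unfolded estimators_def]] .
  have cm [measurable]: "(\<lambda>x. coef \<phi> (E x) j) \<in> borel_measurable M" for j
    by measurable
  have "(\<Sum>j\<in>J. ennreal (\<omega> j) * coord_loss M \<xi> \<zeta> \<phi> \<psi> \<epsilon> \<sigma> est f T j)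
      = (\<Sum>j\<in>J. \<integral>\<^sup>+x. ennreal (\<omega> j * \<bar>coef \<phi> (E x - f) j\<bar>\<^sup>2) \<partial>M)"
  proof (rule sum.cong[OF refl])
    fix j assume "j \<in> J"
    have "ennreal (\<omega> j) * coord_loss M \<xi> \<zeta> \<phi> \<psi> \<epsilon> \<sigma> est f T j
        = (\<integral>\<^sup>+x. ennreal (\<omega> j) * ennreal ((coef \<phi> (E x) j - coef \<phi> f j)\<^sup>2) \<partial>M)"
      unfolding coord_loss_def E_def[symmetric] by (rule nn_integral_cmult[symmetric]) measurable
    also have "\<dots> = (\<integral>\<^sup>+x. ennreal (\<omega> j * \<bar>coef \<phi> (E x - f) j\<bar>\<^sup>2) \<partial>M)"
      using \<omega>[OF \<open>j \<in> J\<close>] by (simp add: ennreal_mult coef_def inner_diff_left)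
    finally show "ennreal (\<omega> j) * coord_loss M \<xi> \<zeta> \<phi> \<psi> \<epsilon> \<sigma> est f T j
        = (\<integral>\<^sup>+x. ennreal (\<omega> j * \<bar>coef \<phi> (E x - f) j\<bar>\<^sup>2) \<partial>M)" .
  qed
  also have "\<dots> = (\<integral>\<^sup>+x. (\<Sum>j\<in>J. ennreal (\<omega> j * \<bar>coef \<phi> (E x - f) j\<bar>\<^sup>2)) \<partial>M)"
  proof (rule nn_integral_sum[symmetric])
    fix j
    have "(\<lambda>x. ennreal (\<omega> j * \<bar>coef \<phi> (E x) j - coef \<phi> f j\<bar>\<^sup>2)) \<in> borel_measurable M" by measurable
    then show "(\<lambda>x. ennreal (\<omega> j * \<bar>coef \<phi> (E x - f) j\<bar>\<^sup>2)) \<in> borel_measurable M"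
      by (simp add: coef_def inner_diff_left)
  qed
  also have "\<dots> \<le> risk M \<xi> \<zeta> \<phi> \<psi> \<omega> \<epsilon> \<sigma> est f T"
    unfolding risk_def E_def[symmetric] by (intro nn_integral_mono wnorm_sq_ge_partial_sum J)
  finally show ?thesis .
qed

text \<open>If the observation laws of two parameters differ only in coordinate \<open>i\<close>, by at most \<open>\<surd>2\<close> standard
  deviations, no estimator recovers both of their \<open>j\<close>-th coefficients well. The index \<open>i\<close> of the informative
  observation is independent of \<open>j\<close>: it lies in \<open>Y\<close> when only \<open>f\<close> varies, and in \<open>X\<close> when the change
  of \<open>f\<close> is masked by that of \<open>T\<close>.\<close>
lemma coordinate_loss_two_point:
  assumes noise: "iid_std_normal_noise M \<xi> \<zeta>" and est: "est \<in> estimators"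
    and \<epsilon>: "\<epsilon> > 0" and \<sigma>: "\<sigma> > 0" and i: "i \<in> {1..} <+> {1..}"
    and agree: "\<And>l. l \<in> {1..} <+> {1..} \<Longrightarrow> l \<noteq> i \<Longrightarrow> mean_vec \<phi> \<psi> f T l = mean_vec \<phi> \<psi> f' T' l"
    and close: "(mean_vec \<phi> \<psi> f T i - mean_vec \<phi> \<psi> f' T' i)\<^sup>2 \<le> 2 * case_sum (\<lambda>_. \<epsilon>) (\<lambda>_. \<sigma>) i"
  shows "ennreal ((coef \<phi> f j - coef \<phi> f' j)\<^sup>2 / 4)
    \<le> coord_loss M \<xi> \<zeta> \<phi> \<psi> \<epsilon> \<sigma> est f T j + coord_loss M \<xi> \<zeta> \<phi> \<psi> \<epsilon> \<sigma> est f' T' j"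
proof -
  define I :: "(nat + nat) set" where "I = {1..} <+> {1..}"
  define W where "W = case_sum \<xi> \<zeta>"
  define s where "s = case_sum (\<lambda>_::nat. sqrt \<epsilon>) (\<lambda>_::nat. sqrt \<sigma>)"
  define g where "g w = coef \<phi> (est (\<lambda>l\<in>{1..}. w (Inr l), \<lambda>l\<in>{1..}. w (Inl l))) j" for w
  have "(\<lambda>w. (\<lambda>l\<in>{1..}. w (Inr l), \<lambda>l\<in>{1..}. w (Inl l)))
      \<in> measurable (PiM I (\<lambda>_. borel)) (PiM {1..} (\<lambda>_. borel) \<Otimes>\<^sub>M PiM {1..} (\<lambda>_. borel))"
    by (intro measurable_Pair measurable_restrict measurable_component_singleton) (auto simp: I_def)
  from measurable_compose[OF this est[unfolded estimators_def]]
  have g: "g \<in> borel_measurable (PiM I (\<lambda>_. borel))"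
    unfolding g_def by measurable
  have loss: "coord_loss M \<xi> \<zeta> \<phi> \<psi> \<epsilon> \<sigma> est h U j =
      (\<integral>\<^sup>+x. ennreal ((g (\<lambda>l\<in>I. mean_vec \<phi> \<psi> h U l + s l * W l x) - coef \<phi> h j)\<^sup>2) \<partial>M)" for h U
  proof -
    have "(\<lambda>l\<in>{1..}. (\<lambda>l\<in>I. mean_vec \<phi> \<psi> h U l + s l * W l x) (Inr l)) = obs_X \<phi> \<psi> \<zeta> \<sigma> U x"
      "(\<lambda>l\<in>{1..}. (\<lambda>l\<in>I. mean_vec \<phi> \<psi> h U l + s l * W l x) (Inl l)) = obs_Y \<phi> \<psi> \<xi> \<epsilon> h U x" for x
      by (auto simp: fun_eq_iff obs_X_def obs_Y_def I_def mean_vec_def s_def W_def)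
    then show ?thesis unfolding coord_loss_def g_def by presburger
  qed
  have M: "prob_space M" and ind: "prob_space.indep_vars M (\<lambda>_. borel) W I"
    using noise by (auto simp: iid_std_normal_noise_def I_def W_def)
  have Wi: "distributed M lborel (W i) std_normal_density"
    using noise i by (auto simp: iid_std_normal_noise_def W_def)
  have s: "s i > 0" "(s i)\<^sup>2 = case_sum (\<lambda>_. \<epsilon>) (\<lambda>_. \<sigma>) i"
    using \<epsilon> \<sigma> by (auto simp: s_def split: sum.split)
  show ?thesis
    unfolding loss
    by (rule independent_shift_two_point[OF M ind _ Wi g])
       (use i agree close s in \<open>auto simp: I_def\<close>)
qed

text \<open>A hypercube of parameters \<open>(F \<theta>, U \<theta>)\<close> in which moving along the \<open>j\<close>-th edge changes the \<open>j\<close>-th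
  coefficient by \<open>2 \<surd>(b j)\<close> but is visible only in the observation \<open>i j\<close>. The risk dominates the
  weighted sum of the coordinate losses, to which the pairing over the cube applies.\<close>
lemma assouad_risk_bound:
  fixes F :: "nat set \<Rightarrow> 'h::real_inner" and U :: "nat set \<Rightarrow> 'h \<Rightarrow> 'g::real_inner"
  assumes noise: "iid_std_normal_noise M \<xi> \<zeta>" and est: "est \<in> estimators"
    and \<epsilon>: "\<epsilon> > 0" and \<sigma>: "\<sigma> > 0" and J: "finite J" "J \<subseteq> {1..}"
    and \<omega>: "\<And>j. j \<in> J \<Longrightarrow> \<omega> j \<ge> 0" and b: "\<And>j. j \<in> J \<Longrightarrow> b j \<ge> 0"
    and mem: "\<And>\<theta>. \<theta> \<subseteq> J \<Longrightarrow> F \<theta> \<in> A" "\<And>\<theta>. \<theta> \<subseteq> J \<Longrightarrow> U \<theta> \<in> B"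
    and sep: "\<And>j \<theta>. j \<in> J \<Longrightarrow> \<theta> \<subseteq> J - {j} \<Longrightarrow>
      (coef \<phi> (F \<theta>) j - coef \<phi> (F (insert j \<theta>)) j)\<^sup>2 = 4 * b j"
    and i: "\<And>j. j \<in> J \<Longrightarrow> i j \<in> {1..} <+> {1..}"
    and agree: "\<And>j \<theta> l. j \<in> J \<Longrightarrow> \<theta> \<subseteq> J - {j} \<Longrightarrow> l \<in> {1..} <+> {1..} \<Longrightarrow> l \<noteq> i j \<Longrightarrow>
      mean_vec \<phi> \<psi> (F \<theta>) (U \<theta>) l = mean_vec \<phi> \<psi> (F (insert j \<theta>)) (U (insert j \<theta>)) l"
    and close: "\<And>j \<theta>. j \<in> J \<Longrightarrow> \<theta> \<subseteq> J - {j} \<Longrightarrow>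
      (mean_vec \<phi> \<psi> (F \<theta>) (U \<theta>) (i j) - mean_vec \<phi> \<psi> (F (insert j \<theta>)) (U (insert j \<theta>)) (i j))\<^sup>2
        \<le> 2 * case_sum (\<lambda>_. \<epsilon>) (\<lambda>_. \<sigma>) (i j)"
  shows "ennreal (\<Sum>j\<in>J. \<omega> j * b j / 2) \<le> (SUP f\<in>A. SUP T\<in>B. risk M \<xi> \<zeta> \<phi> \<psi> \<omega> \<epsilon> \<sigma> est f T)"
proof (rule assouad_pairing[OF J(1),
    where r = "\<lambda>j \<theta>. ennreal (\<omega> j) * coord_loss M \<xi> \<zeta> \<phi> \<psi> \<epsilon> \<sigma> est (F \<theta>) (U \<theta>) j"])
  fix \<theta> assume \<theta>: "\<theta> \<subseteq> J"
  have "(\<Sum>j\<in>J. ennreal (\<omega> j) * coord_loss M \<xi> \<zeta> \<phi> \<psi> \<epsilon> \<sigma> est (F \<theta>) (U \<theta>) j)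
      \<le> risk M \<xi> \<zeta> \<phi> \<psi> \<omega> \<epsilon> \<sigma> est (F \<theta>) (U \<theta>)"
    by (rule risk_ge_coordinate_losses[OF noise est J \<omega>])
  also have "\<dots> \<le> (SUP f\<in>A. SUP T\<in>B. risk M \<xi> \<zeta> \<phi> \<psi> \<omega> \<epsilon> \<sigma> est f T)"
    by (rule SUP_upper2[OF mem(1)[OF \<theta>]], rule SUP_upper[OF mem(2)[OF \<theta>]])
  finally show "(\<Sum>j\<in>J. ennreal (\<omega> j) * coord_loss M \<xi> \<zeta> \<phi> \<psi> \<epsilon> \<sigma> est (F \<theta>) (U \<theta>) j)
      \<le> (SUP f\<in>A. SUP T\<in>B. risk M \<xi> \<zeta> \<phi> \<psi> \<omega> \<epsilon> \<sigma> est f T)" .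
next
  fix j assume "j \<in> J"
  then show "0 \<le> \<omega> j * b j / 2" using \<omega> b by simp
next
  fix j \<theta> assume j: "j \<in> J" and \<theta>: "\<theta> \<subseteq> J - {j}"
  have "ennreal (2 * (\<omega> j * b j / 2)) = ennreal (\<omega> j) * ennreal (4 * b j / 4)"
    using \<omega>[OF j] by (simp add: ennreal_mult')
  also have "\<dots> \<le> ennreal (\<omega> j) * (coord_loss M \<xi> \<zeta> \<phi> \<psi> \<epsilon> \<sigma> est (F \<theta>) (U \<theta>) j
      + coord_loss M \<xi> \<zeta> \<phi> \<psi> \<epsilon> \<sigma> est (F (insert j \<theta>)) (U (insert j \<theta>)) j)"
    using coordinate_loss_two_point[OF noise est \<epsilon> \<sigma> i[OF j] agree[OF j \<theta>] close[OF j \<theta>]]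
    unfolding sep[OF j \<theta>, symmetric] by (intro mult_left_mono) auto
  finally show "ennreal (2 * (\<omega> j * b j / 2)) \<le>
      ennreal (\<omega> j) * coord_loss M \<xi> \<zeta> \<phi> \<psi> \<epsilon> \<sigma> est (F \<theta>) (U \<theta>) j
      + ennreal (\<omega> j) * coord_loss M \<xi> \<zeta> \<phi> \<psi> \<epsilon> \<sigma> est (F (insert j \<theta>)) (U (insert j \<theta>)) j"
    by (simp add: distrib_left)
qed

section \<open>Two families of least favourable parameters\<close>

lemma coef_orthonormal_sum:
  assumes "orthonormal_system \<phi>" "finite J" "J \<subseteq> {1..}" "i \<ge> 1"
  shows "coef \<phi> (\<Sum>j\<in>J. c j *\<^sub>R \<phi> j) i = (if i \<in> J then c i else 0)"
  unfolding coef_def by (rule inner_orthonormal_sum[OF assms])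

lemma orthonormal_sum_in_sol_class:
  assumes \<phi>: "orthonormal_system \<phi>" and J: "finite J" "J \<subseteq> {1..}"
    and \<gamma>: "\<And>j. j \<in> J \<Longrightarrow> \<gamma> j \<ge> 0" and bound: "(\<Sum>j\<in>J. \<gamma> j * (c j)\<^sup>2) \<le> r"
  shows "(\<Sum>j\<in>J. c j *\<^sub>R \<phi> j) \<in> sol_class \<phi> \<gamma> r"
proof -
  have "wnorm_sq \<phi> \<gamma> (\<Sum>j\<in>J. c j *\<^sub>R \<phi> j) = (\<Sum>\<^sub>\<infinity>j\<in>J. ennreal (\<gamma> j * (c j)\<^sup>2))"
    unfolding wnorm_sq_def using J
    by (intro infsum_cong_neutral) (auto simp: coef_orthonormal_sum[OF \<phi> J] subset_iff)
  also have "\<dots> = ennreal (\<Sum>j\<in>J. \<gamma> j * (c j)\<^sup>2)" using J \<gamma> by (simp add: sum_ennreal)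
  finally show ?thesis using bound by (simp add: sol_class_def ennreal_leI)
qed

text \<open>The factor \<open>c\<close> in the squared coefficients \<open>c \<epsilon> / \<lambda>\<^sub>j\<close> has two constraints. With \<open>a\<^sub>j\<^sup>2 = \<lambda>\<^sub>j\<close>, a
  sign flip moves the mean of \<open>Y\<^sub>j\<close> by \<open>2 \<surd>(c \<epsilon>)\<close>, which allows \<open>c \<le> 1/2\<close>. With \<open>A = \<omega>\<^sub>k / \<gamma>\<^sub>k\<close> and
  \<open>S = \<Sum>\<^sub>j\<^sub>\<le>\<^sub>k \<epsilon> \<omega>\<^sub>j / \<lambda>\<^sub>j\<close>, the monotonicity of \<open>\<omega> / \<gamma>\<close> gives \<open>\<gamma>\<^sub>j \<le> \<omega>\<^sub>j / A\<close>, so the ellipsoid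
  contains the cube if \<open>c S \<le> r A\<close>. The resulting bound is \<open>c S / 2\<close>.\<close>
lemma known_operator_bound:
  fixes \<phi> :: "nat \<Rightarrow> 'h::real_inner" and \<psi> :: "nat \<Rightarrow> 'g::{real_inner, polish_space}"
  assumes \<phi>: "orthonormal_system \<phi>" and \<psi>: "orthonormal_system \<psi>"
    and noise: "iid_std_normal_noise M \<xi> \<zeta>" and est: "est \<in> estimators"
    and \<epsilon>: "\<epsilon> > 0" and \<sigma>: "\<sigma> > 0" and r: "r > 0" and d: "d \<ge> 1" and k: "k \<ge> 1"
    and \<omega>: "\<And>j. j \<ge> 1 \<Longrightarrow> \<omega> j > 0" and \<gamma>: "\<And>j. j \<ge> 1 \<Longrightarrow> \<gamma> j > 0"
    and lam: "\<And>j. j \<ge> 1 \<Longrightarrow> lam j > 0" "lam \<longlonglongrightarrow> 0"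
    and dec: "\<And>j. j \<in> {1..k} \<Longrightarrow> \<omega> k / \<gamma> k \<le> \<omega> j / \<gamma> j"
  shows "ennreal (min (r * (\<omega> k / \<gamma> k)) (1 / 2 * (\<Sum>j=1..k. \<epsilon> * \<omega> j / lam j)) / 2)
    \<le> (SUP f\<in>sol_class \<phi> \<gamma> r. SUP T\<in>link_class \<phi> \<psi> lam d. risk M \<xi> \<zeta> \<phi> \<psi> \<omega> \<epsilon> \<sigma> est f T)"
proof -
  define J where "J = {1..k}"
  have J: "finite J" "J \<subseteq> {1..}" by (auto simp: J_def)
  define S where "S = (\<Sum>j\<in>J. \<epsilon> * \<omega> j / lam j)"
  define A where "A = \<omega> k / \<gamma> k"
  have S: "S > 0" unfolding S_def using k \<epsilon> \<omega> lam by (intro sum_pos) (auto simp: J_def)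
  have A: "A > 0" using k \<omega> \<gamma> by (simp add: A_def)
  define c where "c = min (r * A / S) (1 / 2)"
  have c: "c \<ge> 0" "c \<le> 1/2" "c * S \<le> r * A" using S A r by (auto simp: c_def min_def field_simps)
  have cS: "c * S = min (r * A) (1 / 2 * S)" using S by (auto simp: c_def min_def field_simps)
  obtain T where T: "T \<in> link_class \<phi> \<psi> lam d" "\<And>j. j \<ge> 1 \<Longrightarrow> sing_val \<phi> \<psi> T j = sqrt (lam j)"
    using link_class_contains[OF \<phi> \<psi> lam(2,1), of "\<lambda>j. sqrt (lam j)" d] lam(1) d
    by (fastforce simp: less_imp_le less_imp_neq[symmetric])
  define b where "b j = c * \<epsilon> / lam j" for j
  have b: "b j \<ge> 0" if "j \<ge> 1" for j using c \<epsilon> lam(1)[OF that] by (simp add: b_def)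
  define u where "u \<theta> j = (if j \<in> \<theta> then 1 else -1) * sqrt (b j)" for \<theta> :: "nat set" and j
  define F where "F \<theta> = (\<Sum>j\<in>J. u \<theta> j *\<^sub>R \<phi> j)" for \<theta>
  have coef_F: "coef \<phi> (F \<theta>) j = (if j \<in> J then u \<theta> j else 0)" if "j \<ge> 1" for \<theta> j
    unfolding F_def by (rule coef_orthonormal_sum[OF \<phi> J that])
  have u_sq: "(u \<theta> j)\<^sup>2 = b j" if "j \<in> J" for \<theta> j
    using b[of j] that J by (auto simp: u_def power_mult_distrib)
  have "ennreal (\<Sum>j\<in>J. \<omega> j * b j / 2)
    \<le> (SUP f\<in>sol_class \<phi> \<gamma> r. SUP T\<in>link_class \<phi> \<psi> lam d. risk M \<xi> \<zeta> \<phi> \<psi> \<omega> \<epsilon> \<sigma> est f T)"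
  proof (rule assouad_risk_bound[OF noise est \<epsilon> \<sigma> J, where F=F and U="\<lambda>_. T" and i=Inl])
    show "F \<theta> \<in> sol_class \<phi> \<gamma> r" for \<theta>
      unfolding F_def
    proof (rule orthonormal_sum_in_sol_class[OF \<phi> J])
      have "\<gamma> j * b j \<le> c / A * (\<epsilon> * \<omega> j / lam j)" if "j \<in> J" for j
      proof -
        have j: "\<gamma> j > 0" "\<omega> j > 0" "lam j > 0" using that \<gamma> \<omega> lam J by auto
        have "A * \<gamma> j \<le> \<omega> j" using dec[of j] that j by (simp add: A_def J_def pos_le_divide_eq)
        then have "\<gamma> j \<le> \<omega> j / A" using A by (simp add: pos_le_divide_eq mult.commute)
        then have "\<gamma> j * b j \<le> \<omega> j / A * b j" using b that J by (intro mult_right_mono) auto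
        then show ?thesis by (simp add: b_def field_simps)
      qed
      then have "(\<Sum>j\<in>J. \<gamma> j * b j) \<le> c / A * S"
        unfolding S_def sum_distrib_left by (rule sum_mono)
      also have "\<dots> \<le> r" using c(3) A by (simp add: field_simps)
      finally show "(\<Sum>j\<in>J. \<gamma> j * (u \<theta> j)\<^sup>2) \<le> r" by (simp add: u_sq)
    qed (use \<gamma> J in \<open>auto intro: less_imp_le\<close>)
    fix j \<theta> assume j: "j \<in> J" and \<theta>: "\<theta> \<subseteq> J - {j}"
    have j1: "j \<ge> 1" using j J by auto
    have diff: "coef \<phi> (F \<theta>) j - coef \<phi> (F (insert j \<theta>)) j = - (2 * sqrt (b j))"
      using j \<theta> j1 by (auto simp: coef_F u_def)
    then show sep: "(coef \<phi> (F \<theta>) j - coef \<phi> (F (insert j \<theta>)) j)\<^sup>2 = 4 * b j"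
      using b[OF j1] by (simp add: power_mult_distrib)
    have "(mean_vec \<phi> \<psi> (F \<theta>) T (Inl j) - mean_vec \<phi> \<psi> (F (insert j \<theta>)) T (Inl j))\<^sup>2 = lam j * (4 * b j)"
      using lam(1)[OF j1]
      by (simp add: mean_vec_def T(2)[OF j1] right_diff_distrib[symmetric] power_mult_distrib sep)
    also have "\<dots> = 4 * c * \<epsilon>" using lam(1)[OF j1] by (simp add: b_def)
    also have "\<dots> \<le> 2 * \<epsilon>" using c(2) \<epsilon> by simp
    finally show "(mean_vec \<phi> \<psi> (F \<theta>) T (Inl j) - mean_vec \<phi> \<psi> (F (insert j \<theta>)) T (Inl j))\<^sup>2
        \<le> 2 * case_sum (\<lambda>_. \<epsilon>) (\<lambda>_. \<sigma>) (Inl j)" by simp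
    fix l :: "nat + nat" assume "l \<in> {1..} <+> {1..}" "l \<noteq> Inl j"
    then show "mean_vec \<phi> \<psi> (F \<theta>) T l = mean_vec \<phi> \<psi> (F (insert j \<theta>)) T l"
      by (auto simp: mean_vec_def coef_F u_def split: if_splits)
  qed (use \<omega> b J T(1) in \<open>auto intro: less_imp_le\<close>)
  also have "(\<Sum>j\<in>J. \<omega> j * b j / 2) = c * S / 2"
    by (simp add: b_def S_def sum_distrib_left sum_divide_distrib ac_simps)
  finally show ?thesis unfolding cS unfolding A_def S_def J_def .
qed

text \<open>A perturbation \<open>t = \<plusminus>\<alpha>\<close> multiplies the \<open>k\<close>-th singular value by \<open>1 + t\<close> and the \<open>k\<close>-th coefficient
  by \<open>1 - t\<close>. The product \<open>1 - \<alpha>\<^sup>2\<close> does not depend on the sign, so \<open>Y\<close> carries no information, while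
  the mean of \<open>X\<^sub>k\<close> moves by \<open>2 \<alpha> \<surd>\<lambda>\<^sub>k\<close>; this allows \<open>\<alpha>\<^sup>2 \<le> \<sigma> / (2 \<lambda>\<^sub>k)\<close>. The second bound
  \<open>\<alpha> \<le> 1 - 1 / \<surd>d\<close> keeps the operators in their class: it is \<open>1 - \<alpha> \<ge> 1 / \<surd>d\<close>, and it implies
  \<open>1 + \<alpha> \<le> \<surd>d\<close> since \<open>\<surd>d + 1 / \<surd>d \<ge> 2\<close>.\<close>
lemma unknown_operator_bound:
  fixes \<phi> :: "nat \<Rightarrow> 'h::real_inner" and \<psi> :: "nat \<Rightarrow> 'g::{real_inner, polish_space}"
  assumes \<phi>: "orthonormal_system \<phi>" and \<psi>: "orthonormal_system \<psi>"
    and noise: "iid_std_normal_noise M \<xi> \<zeta>" and est: "est \<in> estimators"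
    and \<epsilon>: "\<epsilon> > 0" and \<sigma>: "\<sigma> > 0" and r: "r > 0" and d: "d \<ge> 1" and k: "k \<ge> 1"
    and \<omega>: "\<And>j. j \<ge> 1 \<Longrightarrow> \<omega> j > 0" and \<gamma>: "\<And>j. j \<ge> 1 \<Longrightarrow> \<gamma> j > 0"
    and lam: "\<And>j. j \<ge> 1 \<Longrightarrow> lam j > 0" "lam \<longlonglongrightarrow> 0"
  shows "ennreal (r / (2 * d) * (\<omega> k / \<gamma> k) * min (\<sigma> / (2 * lam k)) ((1 - 1 / sqrt d)\<^sup>2))
    \<le> (SUP f\<in>sol_class \<phi> \<gamma> r. SUP T\<in>link_class \<phi> \<psi> lam d. risk M \<xi> \<zeta> \<phi> \<psi> \<omega> \<epsilon> \<sigma> est f T)"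
proof -
  have sd: "sqrt d \<ge> 1" using d by simp
  define \<alpha> where "\<alpha> = sqrt (min (\<sigma> / (2 * lam k)) ((1 - 1 / sqrt d)\<^sup>2))"
  have lk: "lam k > 0" "\<gamma> k > 0" "\<omega> k > 0" using lam \<gamma> \<omega> k by auto
  have \<alpha>2: "\<alpha>\<^sup>2 = min (\<sigma> / (2 * lam k)) ((1 - 1 / sqrt d)\<^sup>2)"
    using \<sigma> lk by (simp add: \<alpha>_def)
  have inv1: "1 / sqrt d \<le> 1" "1 / sqrt d > 0" using sd by auto
  have "\<alpha> \<le> sqrt ((1 - 1 / sqrt d)\<^sup>2)" unfolding \<alpha>_def by (rule real_sqrt_le_mono) simp
  then have \<alpha>: "\<alpha> \<ge> 0" "\<alpha> \<le> 1 - 1 / sqrt d" using \<sigma> lk inv1 by (auto simp: \<alpha>_def)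
  have up: "1 + \<alpha> \<le> sqrt d"
  proof -
    have "0 \<le> (sqrt d - 1)\<^sup>2 / sqrt d" using sd by simp
    also have "\<dots> = sqrt d + 1 / sqrt d - 2" using sd d by (simp add: power2_eq_square field_simps)
    finally show ?thesis using \<alpha>(2) by linarith
  qed
  define t where "t \<theta> = (if k \<in> \<theta> then \<alpha> else - \<alpha>)" for \<theta> :: "nat set"
  have t: "1 / sqrt d \<le> 1 + t \<theta>" "1 + t \<theta> \<le> sqrt d" "1 - t \<theta> \<le> sqrt d" "1 - t \<theta> \<ge> 0" for \<theta>
    unfolding t_def by (split if_split; use \<alpha> up inv1 in linarith)+
  have "\<exists>T\<in>link_class \<phi> \<psi> lam d. \<forall>j\<ge>1. sing_val \<phi> \<psi> T j = (if j = k then 1 + t \<theta> else 1) * sqrt (lam j)" for \<theta>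
  proof (rule link_class_contains[OF \<phi> \<psi> lam(2,1)])
    fix j :: nat assume j: "j \<ge> 1"
    define e where "e = (if j = k then 1 + t \<theta> else 1)"
    have e: "1 / sqrt d \<le> e" "e \<le> sqrt d" using t inv1 sd by (auto simp: e_def)
    have e0: "e > 0" using e(1) inv1(2) by linarith
    have "(1 / sqrt d)\<^sup>2 \<le> e\<^sup>2" "e\<^sup>2 \<le> (sqrt d)\<^sup>2"
      by (rule power_mono, use e e0 inv1 in linarith, use e0 inv1 in linarith)+
    then have e2: "1 / d \<le> e\<^sup>2" "e\<^sup>2 \<le> d" using d by (auto simp: power_divide)
    show "(if j = k then 1 + t \<theta> else 1) * sqrt (lam j) > 0"
      unfolding e_def[symmetric] using e0 lam(1)[OF j] by simp
    show "1 / d \<le> ((if j = k then 1 + t \<theta> else 1) * sqrt (lam j))\<^sup>2 / lam j"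
      "((if j = k then 1 + t \<theta> else 1) * sqrt (lam j))\<^sup>2 / lam j \<le> d"
      unfolding e_def[symmetric] using e2 lam(1)[OF j] by (simp_all add: power_mult_distrib)
  qed
  then obtain U where U: "\<And>\<theta>. U \<theta> \<in> link_class \<phi> \<psi> lam d"
    "\<And>\<theta> j. j \<ge> 1 \<Longrightarrow> sing_val \<phi> \<psi> (U \<theta>) j = (if j = k then 1 + t \<theta> else 1) * sqrt (lam j)"
    by metis
  \<comment> \<open>Since \<open>(1 + \<alpha>)\<^sup>2 \<le> d\<close>, an amplitude with \<open>\<gamma>\<^sub>k v\<^sup>2 = r / d\<close> keeps both coefficients in the ellipsoid.\<close>
  define v where "v = sqrt (r / (d * \<gamma> k))"
  have v2: "v\<^sup>2 = r / (d * \<gamma> k)" using r d lk by (simp add: v_def)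
  define F where "F \<theta> = (\<Sum>j\<in>{k}. ((1 - t \<theta>) * v) *\<^sub>R \<phi> j)" for \<theta>
  have J: "finite {k}" "{k} \<subseteq> {1..}" using k by auto
  have coef_F: "coef \<phi> (F \<theta>) j = (if j = k then (1 - t \<theta>) * v else 0)" if "j \<ge> 1" for \<theta> j
    unfolding F_def using coef_orthonormal_sum[OF \<phi> J that, of "\<lambda>_. (1 - t \<theta>) * v"] by simp
  have "ennreal (\<Sum>j\<in>{k}. \<omega> j * (\<alpha>\<^sup>2 * v\<^sup>2) / 2)
    \<le> (SUP f\<in>sol_class \<phi> \<gamma> r. SUP T\<in>link_class \<phi> \<psi> lam d. risk M \<xi> \<zeta> \<phi> \<psi> \<omega> \<epsilon> \<sigma> est f T)"
  proof (rule assouad_risk_bound[OF noise est \<epsilon> \<sigma> J, where F=F and U=U and i=Inr])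
    show "F \<theta> \<in> sol_class \<phi> \<gamma> r" for \<theta>
      unfolding F_def
    proof (rule orthonormal_sum_in_sol_class[OF \<phi> J])
      have "(1 - t \<theta>)\<^sup>2 \<le> (sqrt d)\<^sup>2" by (rule power_mono) (rule t)+
      then have "(1 - t \<theta>)\<^sup>2 \<le> d" using d by simp
      then have "\<gamma> k * ((1 - t \<theta>)\<^sup>2 * (r / (d * \<gamma> k))) \<le> \<gamma> k * (d * (r / (d * \<gamma> k)))"
        using r d lk by (intro mult_left_mono mult_right_mono) auto
      also have "\<dots> = r" using d lk by simp
      finally show "(\<Sum>j\<in>{k}. \<gamma> j * ((1 - t \<theta>) * v)\<^sup>2) \<le> r" by (simp add: power_mult_distrib v2)
    qed (use lk in auto)
    fix j \<theta> assume j: "j \<in> {k}" and \<theta>: "\<theta> \<subseteq> {k} - {j}"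
    have tt: "t \<theta> = - \<alpha>" "t (insert j \<theta>) = \<alpha>" "j = k" using j \<theta> by (auto simp: t_def)
    have "coef \<phi> (F \<theta>) j - coef \<phi> (F (insert j \<theta>)) j = 2 * (\<alpha> * v)"
      using tt k by (simp add: coef_F algebra_simps)
    then show "(coef \<phi> (F \<theta>) j - coef \<phi> (F (insert j \<theta>)) j)\<^sup>2 = 4 * (\<alpha>\<^sup>2 * v\<^sup>2)"
      by (simp add: power_mult_distrib)
    have "mean_vec \<phi> \<psi> (F \<theta>) (U \<theta>) (Inr j) - mean_vec \<phi> \<psi> (F (insert j \<theta>)) (U (insert j \<theta>)) (Inr j)
        = - 2 * \<alpha> * sqrt (lam k)"
      using tt k by (simp add: mean_vec_def U(2) algebra_simps)
    then have "(mean_vec \<phi> \<psi> (F \<theta>) (U \<theta>) (Inr j) - mean_vec \<phi> \<psi> (F (insert j \<theta>)) (U (insert j \<theta>)) (Inr j))\<^sup>2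
        = 4 * \<alpha>\<^sup>2 * lam k"
      using lk by (simp add: power_mult_distrib)
    also have "\<dots> \<le> 4 * (\<sigma> / (2 * lam k)) * lam k"
      unfolding \<alpha>2 using lk by (intro mult_right_mono mult_left_mono) auto
    also have "\<dots> = 2 * \<sigma>" using lk by simp
    finally show "(mean_vec \<phi> \<psi> (F \<theta>) (U \<theta>) (Inr j) - mean_vec \<phi> \<psi> (F (insert j \<theta>)) (U (insert j \<theta>)) (Inr j))\<^sup>2
        \<le> 2 * case_sum (\<lambda>_. \<epsilon>) (\<lambda>_. \<sigma>) (Inr j)" by simp
    fix l :: "nat + nat" assume "l \<in> {1..} <+> {1..}" "l \<noteq> Inr j"
    then show "mean_vec \<phi> \<psi> (F \<theta>) (U \<theta>) l = mean_vec \<phi> \<psi> (F (insert j \<theta>)) (U (insert j \<theta>)) l"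
      using tt by (auto simp: mean_vec_def coef_F U(2) algebra_simps split: if_splits)
  qed (use lk U(1) k in auto)
  also have "(\<Sum>j\<in>{k}. \<omega> j * (\<alpha>\<^sup>2 * v\<^sup>2) / 2) = r / (2 * d) * (\<omega> k / \<gamma> k) * \<alpha>\<^sup>2"
    by (simp add: v2 field_simps)
  finally show ?thesis unfolding \<alpha>2 .
qed

section \<open>The minimax lower bound\<close>

text \<open>For \<open>R = \<infinity>\<close> the claim is trivial; a finite \<open>R\<close> bounds the range of \<open>g\<close> unless \<open>C = 0\<close>, so the real
  supremum is a genuine one exactly where its value matters.\<close>
lemma ennreal_scaled_cSUP_le:
  fixes g :: "'a \<Rightarrow> real"
  assumes K: "K \<noteq> {}" and C: "C \<ge> 0" and le: "\<And>k. k \<in> K \<Longrightarrow> ennreal (C * g k) \<le> R"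
    and g: "\<And>k. k \<in> K \<Longrightarrow> g k \<ge> 0"
  shows "ennreal (C * (SUP k\<in>K. g k)) \<le> R"
proof (cases R)
  case (real x)
  show ?thesis
  proof (cases "C = 0")
    case False
    have "g k \<le> x / C" if "k \<in> K" for k
      using le[OF that] real C False g[OF that] by (simp add: pos_le_divide_eq mult.commute)
    then have "(SUP k\<in>K. g k) \<le> x / C" by (intro cSUP_least K)
    then have "C * (SUP k\<in>K. g k) \<le> x" using C False by (simp add: pos_le_divide_eq mult.commute)
    then show ?thesis using real by (simp add: ennreal_leI)
  qed simp
qed simp

lemma kappa_attained:
  assumes pos: "\<And>j. j \<ge> 1 \<Longrightarrow> \<omega> j > 0" "\<And>j. j \<ge> 1 \<Longrightarrow> \<gamma> j > 0"
    and att: "rho_min_attained \<omega> \<gamma> lam \<epsilon>"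
  shows "kstar \<omega> \<gamma> lam \<epsilon> \<ge> 1" "kappa \<omega> \<gamma> lam \<epsilon> = rho \<omega> \<gamma> lam \<epsilon> (kstar \<omega> \<gamma> lam \<epsilon>)"
    "kappa \<omega> \<gamma> lam \<epsilon> > 0"
proof -
  let ?k = "kstar \<omega> \<gamma> lam \<epsilon>"
  have k: "?k \<ge> 1 \<and> (\<forall>l\<ge>1. rho \<omega> \<gamma> lam \<epsilon> ?k \<le> rho \<omega> \<gamma> lam \<epsilon> l)"
    unfolding kstar_def using att unfolding rho_min_attained_def by (rule LeastI_ex)
  then show "?k \<ge> 1" by simp
  show eq: "kappa \<omega> \<gamma> lam \<epsilon> = rho \<omega> \<gamma> lam \<epsilon> ?k"
    unfolding kappa_def using k by (intro cInf_eq_minimum) auto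
  have "\<omega> ?k / \<gamma> ?k > 0" using k pos by simp
  then show "kappa \<omega> \<gamma> lam \<epsilon> > 0" unfolding eq by (simp add: rho_def)
qed

text \<open>An infimum of reals lies below the members of the family only if the family is bounded below; here
  \<open>0\<close> is a lower bound, since all weights are positive.\<close>
lemma eta_kappa_le:
  assumes pos: "\<And>j. j \<ge> 1 \<Longrightarrow> \<omega> j > 0" "\<And>j. j \<ge> 1 \<Longrightarrow> \<gamma> j > 0" "\<And>j. j \<ge> 1 \<Longrightarrow> lam j > 0"
    and att: "\<And>\<epsilon>. \<epsilon> \<in> {0<..<1} \<Longrightarrow> rho_min_attained \<omega> \<gamma> lam \<epsilon>"
    and \<epsilon>: "\<epsilon> \<in> {0<..<1}"
  defines "k \<equiv> kstar \<omega> \<gamma> lam \<epsilon>"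
  shows "eta \<omega> \<gamma> lam * kappa \<omega> \<gamma> lam \<epsilon> \<le> min (\<omega> k / \<gamma> k) (\<Sum>l=1..k. \<epsilon> * \<omega> l / lam l)"
proof -
  define B where "B \<epsilon> = inverse (kappa \<omega> \<gamma> lam \<epsilon>) *
       min (\<omega> (kstar \<omega> \<gamma> lam \<epsilon>) / \<gamma> (kstar \<omega> \<gamma> lam \<epsilon>)) (\<Sum>l=1..kstar \<omega> \<gamma> lam \<epsilon>. \<epsilon> * \<omega> l / lam l)" for \<epsilon>
  have kap: "kstar \<omega> \<gamma> lam e \<ge> 1" "kappa \<omega> \<gamma> lam e > 0" if "e \<in> {0<..<1}" for e
    using kappa_attained[OF pos(1,2) att[OF that]] by auto
  have B0: "B e \<ge> 0" if e: "e \<in> {0<..<1}" for e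
    unfolding B_def using e kap[OF e] pos
    by (intro mult_nonneg_nonneg min.boundedI divide_nonneg_nonneg sum_nonneg) (auto intro: less_imp_le)
  have "eta \<omega> \<gamma> lam \<le> B \<epsilon>"
    unfolding eta_def B_def[symmetric] using B0 \<epsilon> by (intro cINF_lower) (auto intro!: bdd_belowI2[of _ 0])
  then have "eta \<omega> \<gamma> lam * kappa \<omega> \<gamma> lam \<epsilon> \<le> B \<epsilon> * kappa \<omega> \<gamma> lam \<epsilon>"
    using kap(2)[OF \<epsilon>] by simp
  also have "\<dots> = min (\<omega> k / \<gamma> k) (\<Sum>l=1..k. \<epsilon> * \<omega> l / lam l)"
    using kap(2)[OF \<epsilon>] by (simp add: B_def k_def)
  finally show ?thesis .
qed

text \<open>The two hypercube bounds leave room for the stated constant \<open>C\<close>. At \<open>k = k\<^sup>*\<close> the first one is at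
  least \<open>min r (1/2) \<eta> \<kappa> / 2\<close>, and \<open>C \<le> min r (1/2) \<eta> / 4\<close>. The second one, for every \<open>k\<close>, is at least
  \<open>r / (2 d) min (1/2) D\<close> times the \<open>k\<close>-th term of \<open>\<upsilon>\<close>, with \<open>D = (1 - 1 / \<surd>d)\<^sup>2\<close>, and
  \<open>C \<le> r / (4 d) min (1/2) D\<close>.\<close>
theorem theorem2p3:
  fixes \<phi> :: "nat \<Rightarrow> 'h::{real_inner, polish_space}"
    and \<psi> :: "nat \<Rightarrow> 'g::{real_inner, polish_space}"
    and \<omega> \<gamma> lam :: "nat \<Rightarrow> real"
    and r d :: real
    and M :: "'m measure"
    and \<xi> \<zeta> :: "nat \<Rightarrow> 'm \<Rightarrow> real"
  assumes "orthonormal_basis \<phi>"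
    and "orthonormal_system \<psi>"
    and "iid_std_normal_noise M \<xi> \<zeta>"
    and "r > 0" and "d \<ge> 1"
    and "\<forall>j\<ge>1. \<omega> j > 0" and "\<forall>j\<ge>1. \<gamma> j > 0" and "\<forall>j\<ge>1. lam j > 0"
    and "\<gamma> 1 = 1" and "\<omega> 1 = 1" and "lam 1 = 1"
    and "\<forall>i\<ge>1. \<forall>j\<ge>i. \<omega> j / \<gamma> j \<le> \<omega> i / \<gamma> i"
    and "\<forall>i\<ge>1. \<forall>j\<ge>i. lam j \<le> lam i"
    and "lam \<longlonglongrightarrow> 0"
    and "\<forall>\<epsilon>\<in>{0<..<1}. rho_min_attained \<omega> \<gamma> lam \<epsilon>"
    and "eta \<omega> \<gamma> lam > 0"
  shows "\<forall>\<epsilon>\<in>{0<..<1}. \<forall>\<sigma>\<in>{0<..<1}.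
    (INF est\<in>estimators. SUP f\<in>sol_class \<phi> \<gamma> r. SUP T\<in>link_class \<phi> \<psi> lam d.
        risk M \<xi> \<zeta> \<phi> \<psi> \<omega> \<epsilon> \<sigma> est f T)
    \<ge> ennreal (1 / (4 * d) * min (eta \<omega> \<gamma> lam) r
        * min r (min (1 / (2 * d)) ((1 - d powr (-1/2))\<^sup>2))
        * max (kappa \<omega> \<gamma> lam \<epsilon>) (upsilon \<omega> \<gamma> lam \<sigma>))"
proof (intro ballI INF_greatest)
  fix \<epsilon> \<sigma> :: real and est :: "(nat \<Rightarrow> real) \<times> (nat \<Rightarrow> real) \<Rightarrow> 'h"
  assume \<epsilon>: "\<epsilon> \<in> {0<..<1}" and \<sigma>: "\<sigma> \<in> {0<..<1}" and est: "est \<in> estimators"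
  have \<phi>: "orthonormal_system \<phi>" using assms(1) by (simp add: orthonormal_basis_def)
  have r: "r > 0" and d: "d \<ge> 1" by fact+
  have pos: "\<omega> j > 0" "\<gamma> j > 0" "lam j > 0" if "j \<ge> 1" for j using assms that by auto
  have att: "rho_min_attained \<omega> \<gamma> lam e" if "e \<in> {0<..<1}" for e using assms that by auto
  let ?R = "SUP f\<in>sol_class \<phi> \<gamma> r. SUP T\<in>link_class \<phi> \<psi> lam d. risk M \<xi> \<zeta> \<phi> \<psi> \<omega> \<epsilon> \<sigma> est f T"
  have e0: "\<epsilon> > 0" "\<sigma> > 0" using \<epsilon> \<sigma> by auto
  define \<eta> where "\<eta> = eta \<omega> \<gamma> lam"
  define D where "D = (1 - 1 / sqrt d)\<^sup>2"
  define C where "C = 1 / (4 * d) * min \<eta> r * min r (min (1 / (2 * d)) D)"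
  have D: "(1 - d powr (-1/2))\<^sup>2 = D"
    using d by (simp add: D_def powr_minus_divide powr_half_sqrt)
  have \<eta>: "\<eta> > 0" using assms by (simp add: \<eta>_def)
  have m0: "min r (min (1 / (2 * d)) D) \<ge> 0" "min \<eta> r \<ge> 0" using r d \<eta> by (auto simp: D_def)
  have C0: "C \<ge> 0" unfolding C_def using m0 d by (intro mult_nonneg_nonneg) auto
  have half: "1 / (2 * d) \<le> 1 / 2" "1 / (4 * d) \<le> 1 / 4" using d by (auto simp: field_simps)
  have "ennreal (C * kappa \<omega> \<gamma> lam \<epsilon>) \<le> ?R"
  proof -
    define k where "k = kstar \<omega> \<gamma> lam \<epsilon>"
    define S where "S = (\<Sum>l=1..k. \<epsilon> * \<omega> l / lam l)"
    define A where "A = \<omega> k / \<gamma> k"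
    have k: "k \<ge> 1" and kap: "kappa \<omega> \<gamma> lam \<epsilon> > 0"
      unfolding k_def using kappa_attained[OF pos(1,2) att[OF \<epsilon>]] by auto
    have "\<eta> * kappa \<omega> \<gamma> lam \<epsilon> \<le> min A S"
      unfolding \<eta>_def A_def S_def k_def by (rule eta_kappa_le[OF pos att \<epsilon>])
    then have A: "\<eta> * kappa \<omega> \<gamma> lam \<epsilon> \<le> A" and S: "\<eta> * kappa \<omega> \<gamma> lam \<epsilon> \<le> S" by auto
    have C_le: "C \<le> 1 / 4 * \<eta> * x" if "min r (min (1 / (2 * d)) D) \<le> x" for x
      unfolding C_def using half that m0 \<eta> by (intro mult_mono) auto
    have "C * kappa \<omega> \<gamma> lam \<epsilon> \<le> 1 / 4 * \<eta> * r * kappa \<omega> \<gamma> lam \<epsilon>"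
      using C_le[of r] kap by (intro mult_right_mono) auto
    also have "\<dots> \<le> r * A / 2"
    proof -
      have "r * (\<eta> * kappa \<omega> \<gamma> lam \<epsilon>) \<le> r * A" using A r by (intro mult_left_mono) auto
      moreover have "r * (\<eta> * kappa \<omega> \<gamma> lam \<epsilon>) > 0" using r \<eta> kap by simp
      ultimately show ?thesis by (simp add: ac_simps)
    qed
    finally have 1: "C * kappa \<omega> \<gamma> lam \<epsilon> \<le> r * A / 2" .
    have "C * kappa \<omega> \<gamma> lam \<epsilon> \<le> 1 / 4 * \<eta> * (1 / 2) * kappa \<omega> \<gamma> lam \<epsilon>"
      using C_le[of "1/2"] half kap by (intro mult_right_mono) auto
    also have "\<dots> \<le> 1 / 2 * S / 2" using S mult_pos_pos[OF \<eta> kap] by linarith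
    finally have 2: "C * kappa \<omega> \<gamma> lam \<epsilon> \<le> 1 / 2 * S / 2" .
    have "ennreal (C * kappa \<omega> \<gamma> lam \<epsilon>) \<le> ennreal (min (r * A) (1 / 2 * S) / 2)"
      using 1 2 by (intro ennreal_leI) (auto simp: min_def)
    also have "\<dots> \<le> ?R"
      unfolding A_def S_def
      by (rule known_operator_bound[OF \<phi> assms(2,3) est e0 r d k pos assms(14)]) (use assms(12) in auto)
    finally show ?thesis .
  qed
  moreover have "ennreal (C * upsilon \<omega> \<gamma> lam \<sigma>) \<le> ?R"
    unfolding upsilon_def
  proof (rule ennreal_scaled_cSUP_le[OF _ C0])
    fix k :: nat assume "k \<in> {1..}"
    then have k: "k \<ge> 1" by simp
    have A: "\<omega> k / \<gamma> k > 0" using pos[OF k] by simp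
    define x where "x = \<sigma> / lam k"
    have x: "x > 0" using e0 pos[OF k] by (simp add: x_def)
    show "0 \<le> \<omega> k / \<gamma> k * min 1 (\<sigma> / lam k)" 
      using A x unfolding x_def[symmetric] by (intro mult_nonneg_nonneg) auto
    have D0: "D \<ge> 0" by (simp add: D_def)
    have m_half: "min (1 / (2 * d)) D \<le> 1 / 2" using half by linarith
    have C_le: "C \<le> r / (4 * d) * m" if "min (1 / (2 * d)) D \<le> m" "m \<ge> 0" for m
    proof -
      have "C \<le> 1 / (4 * d) * r * m"
        unfolding C_def using that m0 d r by (intro mult_mono) auto
      then show ?thesis by simp
    qed
    have "C * min 1 x \<le> r / (4 * d) * (1 / 2) * x"
      using C_le[of "1/2"] m_half C0 x r d by (intro mult_mono) auto
    moreover have "C * min 1 x \<le> r / (4 * d) * D * 1"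
      using C_le[of D] D0 C0 x r d by (intro mult_mono) auto
    moreover have "r / (4 * d) * min (x / 2) D = min (r / (4 * d) * (x / 2)) (r / (4 * d) * D)"
      using r d by (simp add: min_mult_distrib_left)
    ultimately have "C * min 1 x \<le> r / (4 * d) * min (x / 2) D" by simp
    also have "\<dots> \<le> r / (2 * d) * min (x / 2) D"
      using r d x D0 by (intro mult_right_mono) (auto simp: field_simps)
    finally have "C * min 1 x * (\<omega> k / \<gamma> k) \<le> r / (2 * d) * min (x / 2) D * (\<omega> k / \<gamma> k)"
      using A by (intro mult_right_mono) auto
    then have "ennreal (C * (\<omega> k / \<gamma> k * min 1 (\<sigma> / lam k)))
        \<le> ennreal (r / (2 * d) * (\<omega> k / \<gamma> k) * min (\<sigma> / (2 * lam k)) D)"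
      by (intro ennreal_leI) (simp add: x_def ac_simps)
    also have "\<dots> \<le> ?R"
      unfolding D_def by (rule unknown_operator_bound[OF \<phi> assms(2,3) est e0 r d k pos assms(14)])
    finally show "ennreal (C * (\<omega> k / \<gamma> k * min 1 (\<sigma> / lam k))) \<le> ?R" .
  qed simp
  ultimately have "ennreal (C * max (kappa \<omega> \<gamma> lam \<epsilon>) (upsilon \<omega> \<gamma> lam \<sigma>)) \<le> ?R"
    by (simp add: max_def)
  then show "ennreal (1 / (4 * d) * min (eta \<omega> \<gamma> lam) r
        * min r (min (1 / (2 * d)) ((1 - d powr (-1/2))\<^sup>2))
        * max (kappa \<omega> \<gamma> lam \<epsilon>) (upsilon \<omega> \<gamma> lam \<sigma>)) \<le> ?R"
    unfolding D C_def \<eta>_def .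
qed

end
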